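(* Consider the setting below with $\boldsymbol V=\boldsymbol I_n$. Assume: (A1) $E(\varepsilon_1^4)<\infty$; (A2) $0<\liminf_{n\to\infty}\min_{j\in\mathcal J}|\boldsymbol X_j^t\boldsymbol X_j/n|$ and $\limsup_{n\to\infty}\max_{j\in\mathcal J}|\boldsymbol X_j^t\boldsymbol X_j/n|<\infty$; (A3) $\liminf_{n\to\infty}n^{-1}\inf_{j\in\mathcal J_-}\|\boldsymbol X_*\boldsymbol\beta_*-\boldsymbol H_j\boldsymbol X_*\boldsymbol\beta_*\|^2>0$, where $\boldsymbol H_j=\boldsymbol X_j(\boldsymbol X_j^t\boldsymbol X_j)^{-1}\boldsymbol X_j^t$. Suppose $\mathcal J_+$ is nonempty, the errors $\varepsilon_1,\dots,\varepsilon_n$ are i.i.d. with mean $0$ and variance $\sigma^2>0$, and the matrices $\boldsymbol W_j$ ($j\in\mathcal J$) are pre-specified positive definite matrices not depending on the data. Let $\hat\jmath$ be the minimizer over $j\in\mathcal J$ of any one of the criteria $\mathrm{IC}_{\pi,1}(j)$, $\mathrm{IC}^*_{\pi,1}(j)$, $\mathrm{IC}_{\pi,2}(j)$, $\mathrm{IC}_r(j)$, $\mathrm{IC}^*_r(j)$. Then $P(\hat\jmath=j_* )\to1$ as $n\to\infty$ (with $p_\omega$ and $p_*$ fixed).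
   Context: Setting: $\boldsymbol X_\omega$ is an $n\times p_\omega$ matrix of rank $p_\omega$ ($p_\omega$ fixed); for each subset $j\subseteq\{1,\dots,p_\omega\}$ with $p_j=\#(j)$ elements, $\boldsymbol X_j$ is the $n\times p_j$ submatrix of columns indexed by $j$; $\mathcal J$ is the set of all such subsets. The data are $\boldsymbol y=\boldsymbol X_*\boldsymbol\beta_*+\boldsymbol\varepsilon$, where $j_*\in\mathcal J$ is the true model, $\boldsymbol X_*=\boldsymbol X_{j_*}$, $p_*=p_{j_*}$, and $\boldsymbol\beta_*\in\mathbb R^{p_*}$ has all components nonzero. $\mathcal J_+=\{j\in\mathcal J: j_*\subseteq j\}$, $\mathcal J_-=\mathcal J\setminus\mathcal J_+$. For each $j$, with $\boldsymbol W_j$ a $p_j\times p_j$ positive definite matrix: $\hat\sigma_j^2=\boldsymbol y^t(\boldsymbol I_n-\boldsymbol H_j)\boldsymbol y/n$, $\tilde\sigma_j^2=\boldsymbol y^t(\boldsymbol I_n-\boldsymbol H_j)\boldsymbol y/(n-p_j)$, $\boldsymbol A_j=\boldsymbol I_n-\boldsymbol X_j(\boldsymbol X_j^t\boldsymbol X_j+\boldsymbol W_j^{-1})^{-1}\boldsymbol X_j^t$; $\mathrm{IC}_{\pi,1}(j)=n\log(2\pi\hat\sigma_j^2)+\log|\boldsymbol W_j\boldsymbol X_j^t\boldsymbol X_j+\boldsymbol I_{p_j}|+\boldsymbol y^t\boldsymbol A_j\boldsymbol y/\hat\sigma_j^2+2n/(n-p_j-2)$; $\mathrm{IC}^*_{\pi,1}(j)=n\log(2\pi\hat\sigma_j^2)+p_j\log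 n+2+\boldsymbol y^t\boldsymbol A_j\boldsymbol y/\hat\sigma_j^2$; $\mathrm{IC}_{\pi,2}(j)=n\log(2\pi\hat\sigma_j^2)+p_j\log n+p_j$; $\mathrm{IC}_r(j)=(n-p_j)\log(2\pi\tilde\sigma_j^2)+\log|\boldsymbol X_j^t\boldsymbol X_j|+(n-p_j)+2(n-p_j)/(n-p_j-2)$; $\mathrm{IC}^*_r(j)=(n-p_j)\log(2\pi\tilde\sigma_j^2)+p_j\log n+(n-p_j)^2/(n-p_j-2)$. *)

theory Defs
  imports "HOL-Probability.Probability" "Jordan_Normal_Form.Determinant" "Jordan_Normal_Form.DL_Submatrix"
begin

text \<open>Matrix inverse of a square matrix (only used where it exists).\<close>
definition minv :: "real mat \<Rightarrow> real mat" where
  "minv A = (SOME B. B \<in> carrier_mat (dim_row A) (dim_row A) \<and>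
                     A * B = 1\<^sub>m (dim_row A) \<and> B * A = 1\<^sub>m (dim_row A))"

definition pos_def_mat :: "nat \<Rightarrow> real mat \<Rightarrow> bool" where
  "pos_def_mat k W \<longleftrightarrow> W \<in> carrier_mat k k \<and> transpose_mat W = W \<and>
     (\<forall>x \<in> carrier_vec k. x \<noteq> 0\<^sub>v k \<longrightarrow> x \<bullet> (W *\<^sub>v x) > 0)"

text \<open>X_j: columns of X indexed by j (in increasing order).\<close>
definition Xsub :: "real mat \<Rightarrow> nat set \<Rightarrow> real mat" where
  "Xsub X j = submatrix X UNIV j"

definition gram :: "real mat \<Rightarrow> nat set \<Rightarrow> real mat" where
  "gram X j = transpose_mat (Xsub X j) * Xsub X j"

definition hat :: "real mat \<Rightarrow> nat set \<Rightarrow> real mat" where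
  "hat X j = Xsub X j * minv (gram X j) * transpose_mat (Xsub X j)"

definition rss :: "real mat \<Rightarrow> real vec \<Rightarrow> nat set \<Rightarrow> real" where
  "rss X y j = y \<bullet> ((1\<^sub>m (dim_row X) - hat X j) *\<^sub>v y)"

definition sig_hat :: "real mat \<Rightarrow> real vec \<Rightarrow> nat set \<Rightarrow> real" where
  "sig_hat X y j = rss X y j / real (dim_row X)"

definition sig_tilde :: "real mat \<Rightarrow> real vec \<Rightarrow> nat set \<Rightarrow> real" where
  "sig_tilde X y j = rss X y j / (real (dim_row X) - real (card j))"

definition Amat :: "(nat set \<Rightarrow> real mat) \<Rightarrow> real mat \<Rightarrow> nat set \<Rightarrow> real mat" where
  "Amat W X j = 1\<^sub>m (dim_row X) - Xsub X j * minv (gram X j + minv (W j)) * transpose_mat (Xsub X j)"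

definition IC_pi1 :: "(nat set \<Rightarrow> real mat) \<Rightarrow> real mat \<Rightarrow> real vec \<Rightarrow> nat set \<Rightarrow> real" where
  "IC_pi1 W X y j = (let n = real (dim_row X); pj = real (card j); s = sig_hat X y j in
     n * ln (2 * pi * s) + ln (det (W j * gram X j + 1\<^sub>m (card j)))
     + (y \<bullet> (Amat W X j *\<^sub>v y)) / s + 2 * n / (n - pj - 2))"

definition IC_pi1_star :: "(nat set \<Rightarrow> real mat) \<Rightarrow> real mat \<Rightarrow> real vec \<Rightarrow> nat set \<Rightarrow> real" where
  "IC_pi1_star W X y j = (let n = real (dim_row X); pj = real (card j); s = sig_hat X y j in
     n * ln (2 * pi * s) + pj * ln n + 2 + (y \<bullet> (Amat W X j *\<^sub>v y)) / s)"

definition IC_pi2 :: "(nat set \<Rightarrow> real mat) \<Rightarrow> real mat \<Rightarrow> real vec \<Rightarrow> nat set \<Rightarrow> real" where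
  "IC_pi2 W X y j = (let n = real (dim_row X); pj = real (card j); s = sig_hat X y j in
     n * ln (2 * pi * s) + pj * ln n + pj)"

definition IC_r :: "(nat set \<Rightarrow> real mat) \<Rightarrow> real mat \<Rightarrow> real vec \<Rightarrow> nat set \<Rightarrow> real" where
  "IC_r W X y j = (let n = real (dim_row X); pj = real (card j); s = sig_tilde X y j in
     (n - pj) * ln (2 * pi * s) + ln (det (gram X j)) + (n - pj) + 2 * (n - pj) / (n - pj - 2))"

definition IC_r_star :: "(nat set \<Rightarrow> real mat) \<Rightarrow> real mat \<Rightarrow> real vec \<Rightarrow> nat set \<Rightarrow> real" where
  "IC_r_star W X y j = (let n = real (dim_row X); pj = real (card j); s = sig_tilde X y j in
     (n - pj) * ln (2 * pi * s) + pj * ln n + (n - pj)\<^sup>2 / (n - pj - 2))"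

end

theory Submission
  imports Defs "Jordan_Normal_Form.Jordan_Normal_Form" "HOL-Real_Asymp.Real_Asymp"
begin

text \<open>Up to a term common to all models and a bounded remainder, each criterion equals
  \<open>n ln rss + |j| ln n\<close>. This holds deterministically for every noise vector \<open>e\<close> with
  \<open>|x\<^sub>a \<bullet> e| \<le> L sqrt n\<close> for all columns \<open>x\<^sub>a\<close> and \<open>e \<bullet> e\<close> of exact order \<open>n\<close>, because the bounds on
  the Gram determinants make the entries of the inverse Gram matrices \<open>O(1/n)\<close> (Cramer's rule).
  A proper supermodel of the true model changes \<open>n ln rss\<close> by \<open>O(1)\<close> only and loses at least \<open>ln n\<close>
  through the penalty; a model missing a true regressor raises \<open>n ln rss\<close> by a multiple of \<open>n\<close>,
  which no penalty of order \<open>ln n\<close> can compensate. By Chebyshev's inequality such noise vectors have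
  limiting probability at least \<open>1 - O(1/L\<^sup>2)\<close>, and \<open>L\<close> is arbitrary.\<close>

unbundle no inner_syntax and no vec_syntax

section \<open>Inverses and determinants\<close>

text \<open>(A2) speaks of determinants rather than eigenvalues, but of all submodels at once.
  One-column submodels bound the column norms, hence every Gram entry by a multiple of
  \<open>n\<close>; as the number of columns is fixed, the lower bound on the determinants then
  makes Cramer's rule quantitative. All quadratic forms are estimated through products with the
  columns: noise counts \<open>sqrt n\<close>, the mean counts \<open>n\<close>, and an inverse Gram
  matrix divides by \<open>n\<close>. The matrices \<open>W j\<close> enter as a fixed summand next
  to a Gram matrix of order \<open>n\<close>; the resolvent identity turns their effect into two
  inverse factors, just enough to offset a response of order \<open>n\<close> on both sides.

  The order of the quantifiers matters: \<open>L\<close> is fixed first, and the constants and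
  thresholds in \<open>n\<close> may depend on it but not on the vector in \<open>good L n\<close>,
  so no probability is involved before the last section. A single \<open>L\<close> would not do,
  since the Chebyshev bound for the column products does not decrease with \<open>n\<close>. The
  fourth moment makes \<open>e \<bullet> e\<close> concentrate by the same inequality.\<close>

lemma norm_bound_realD:
  fixes A :: "real mat"
  assumes "norm_bound A b" "A \<in> carrier_mat m k" "i < m" "l < k"
  shows "\<bar>A $$ (i, l)\<bar> \<le> b"
  using assms unfolding norm_bound_def by auto

text \<open>\<open>minv\<close> is defined by choice, so an inverse must first be exhibited: the
  adjugate divided by the determinant.\<close>

lemma minv_inverts:
  assumes "A \<in> carrier_mat k k" "det A \<noteq> 0"
  shows "minv A \<in> carrier_mat k k" "A * minv A = 1\<^sub>m k" "minv A * A = 1\<^sub>m k"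
proof -
  let ?B = "(1 / det A) \<cdot>\<^sub>m adj_mat A"
  have "?B \<in> carrier_mat k k \<and> A * ?B = 1\<^sub>m k \<and> ?B * A = 1\<^sub>m k"
    using adj_mat[OF assms(1)] assms
    by (auto simp: mult_smult_distrib[OF assms(1) adj_mat(1)[OF assms(1)]] 
        mult_smult_assoc_mat[OF adj_mat(1)[OF assms(1)] assms(1)])
  moreover have "dim_row A = k" using assms by auto
  ultimately have "minv A \<in> carrier_mat k k \<and> A * minv A = 1\<^sub>m k \<and> minv A * A = 1\<^sub>m k"
    unfolding minv_def by (smt (verit) someI_ex)
  then show "minv A \<in> carrier_mat k k" "A * minv A = 1\<^sub>m k" "minv A * A = 1\<^sub>m k" by auto
qed

text \<open>Multiplicativity of the determinant makes a one-sided check suffice; the formulas for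
  transposes and multiples then need only one product.\<close>

lemma minv_unique:
  assumes A: "A \<in> carrier_mat k k" and B: "B \<in> carrier_mat k k" and BA: "B * A = 1\<^sub>m k"
  shows "minv A = B"
proof -
  have "det B * det A = 1" using det_mult[OF B A] BA by simp
  then have d: "det A \<noteq> 0" by auto
  note m = minv_inverts[OF A d]
  have "B = B * (A * minv A)" using m B by simp
  also have "\<dots> = minv A" using assoc_mult_mat[OF B A m(1)] BA m by simp
  finally show ?thesis by simp
qed

lemma minv_eq_adj_mat:
  assumes "A \<in> carrier_mat k k" "det A \<noteq> 0"
  shows "minv A = (1 / det A) \<cdot>\<^sub>m adj_mat A"
  using assms adj_mat[OF assms(1)]
  by (intro minv_unique) (auto simp: mult_smult_assoc_mat[OF adj_mat(1)[OF assms(1)] assms(1)])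

lemma minv_transpose:
  assumes "A \<in> carrier_mat k k" "det A \<noteq> 0"
  shows "transpose_mat (minv A) = minv (transpose_mat A)"
proof -
  note m = minv_inverts[OF assms]
  have "transpose_mat (minv A) * transpose_mat A = 1\<^sub>m k"
    using transpose_mult[OF assms(1) m(1)] m by simp
  then show ?thesis using m assms by (intro minv_unique[symmetric]) auto
qed

lemma minv_smult:
  assumes A: "A \<in> carrier_mat k k" "det A \<noteq> 0" and c: "c \<noteq> 0"
  shows "minv (c \<cdot>\<^sub>m A) = (1 / c) \<cdot>\<^sub>m minv A"
proof -
  note m = minv_inverts[OF A]
  have "((1 / c) \<cdot>\<^sub>m minv A) * (c \<cdot>\<^sub>m A) = 1\<^sub>m k"
    using m c A by (simp add: mult_smult_assoc_mat[OF m(1), of _ k] mult_smult_distrib[OF m(1) A(1)])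
       (auto intro!: eq_matI)
  then show ?thesis using m A by (intro minv_unique) auto
qed

text \<open>The Leibniz formula has \<open>fact k\<close> terms, each a product of \<open>k\<close>
  entries. So crude a bound is enough because \<open>k\<close> never exceeds the fixed number of
  columns.\<close>

lemma abs_det_le:
  fixes A :: "real mat"
  assumes A: "A \<in> carrier_mat k k" and b: "norm_bound A b"
  shows "\<bar>det A\<bar> \<le> fact k * b ^ k"
proof -
  have "\<bar>det A\<bar> \<le> (\<Sum>q | q permutes {0..<k}. \<bar>signof q * (\<Prod>i = 0..<k. A $$ (i, q i))\<bar>)"
    unfolding det_def'[OF A] by (rule sum_abs)
  also have "\<dots> \<le> (\<Sum>q | q permutes {0..<k}. b ^ k)"
  proof (rule sum_mono, clarify)
    fix q assume q: "q permutes {0..<k}"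
    have "\<bar>signof q * (\<Prod>i = 0..<k. A $$ (i, q i))\<bar> = (\<Prod>i = 0..<k. \<bar>A $$ (i, q i)\<bar>)"
      by (simp add: abs_mult abs_prod sign_def)
    also have "\<dots> \<le> (\<Prod>i = 0..<k. b)"
      using permutes_in_image[OF q] norm_bound_realD[OF b A] by (intro prod_mono) auto
    finally show "\<bar>signof q * (\<Prod>i = 0..<k. A $$ (i, q i))\<bar> \<le> b ^ k" by simp
  qed
  also have "\<dots> = fact k * b ^ k" by (simp add: card_permutations[where n=k])
  finally show ?thesis .
qed

text \<open>Cramer's rule: an entry of the inverse is a cofactor over the determinant, and a
  cofactor is a determinant of order \<open>k - 1\<close>. The hypothesis \<open>1 \<le> b\<close>
  allows its bound to be written with \<open>k\<close> instead.\<close>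

lemma norm_bound_minv:
  fixes A :: "real mat"
  assumes A: "A \<in> carrier_mat k k" and b: "norm_bound A b" "1 \<le> b" and c: "0 < c" "c \<le> \<bar>det A\<bar>"
  shows "norm_bound (minv A) (fact k * b ^ k / c)"
proof (rule norm_boundI)
  fix i l
  have d: "det A \<noteq> 0" using c by auto
  assume "i < dim_row (minv A)" "l < dim_col (minv A)"
  then have il: "i < k" "l < k" using minv_inverts(1)[OF A d] by auto
  have md: "mat_delete A l i \<in> carrier_mat (k - 1) (k - 1)" using mat_delete_carrier[of A k k] A by auto
  have "norm_bound (mat_delete A l i) b"
    using A b(1) unfolding norm_bound_def mat_delete_def by auto
  from abs_det_le[OF md this]
  have "\<bar>cofactor A l i\<bar> \<le> fact (k - 1) * b ^ (k - 1)"
    by (simp add: cofactor_def abs_mult power_abs)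
  also have "\<dots> \<le> fact k * b ^ k"
    using b(2) by (intro mult_mono power_increasing fact_mono) auto
  finally have 1: "\<bar>cofactor A l i\<bar> \<le> fact k * b ^ k" .
  have "\<bar>minv A $$ (i, l)\<bar> = \<bar>cofactor A l i\<bar> / \<bar>det A\<bar>"
    using il A unfolding minv_eq_adj_mat[OF A d] adj_mat_def by (auto simp: abs_mult)
  also have "\<dots> \<le> fact k * b ^ k / c"
    using 1 c by (intro frac_le) auto
  finally show "norm (minv A $$ (i, l)) \<le> fact k * b ^ k / c" by simp
qed

lemma abs_prod_diff_le:
  fixes f g :: "'b \<Rightarrow> real"
  assumes "finite I" "\<And>i. i \<in> I \<Longrightarrow> \<bar>f i\<bar> \<le> b" "\<And>i. i \<in> I \<Longrightarrow> \<bar>g i\<bar> \<le> b"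
    "\<And>i. i \<in> I \<Longrightarrow> \<bar>f i - g i\<bar> \<le> e" "1 \<le> b"
  shows "\<bar>prod f I - prod g I\<bar> \<le> real (card I) * b ^ card I * e"
  using assms
proof (induction I rule: finite_induct)
  case (insert x I)
  have e: "0 \<le> e" using insert.prems(3)[of x] by auto
  have g: "\<bar>prod g I\<bar> \<le> b ^ card I"
    using insert.prems(2) unfolding abs_prod by (intro prod_le_power) (use insert.prems in auto)
  \<comment> \<open>Telescoping: one factor is exchanged at a time.\<close>
  have "\<bar>prod f (insert x I) - prod g (insert x I)\<bar>
      = \<bar>f x * (prod f I - prod g I) + (f x - g x) * prod g I\<bar>"
    using insert by (simp add: algebra_simps)
  also have "\<dots> \<le> b * (real (card I) * b ^ card I * e) + e * b ^ card I"
    using insert g e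
    by (intro order_trans[OF abs_triangle_ineq] add_mono) (auto simp: abs_mult intro!: mult_mono)
  also have "\<dots> \<le> b * (real (card I) * b ^ card I * e) + e * b ^ Suc (card I)"
    using insert.prems e by (intro add_left_mono mult_left_mono power_increasing) auto
  also have "\<dots> = real (card (insert x I)) * b ^ card (insert x I) * e"
    using insert by (simp add: algebra_simps)
  finally show ?case .
qed simp

text \<open>Lipschitz continuity on bounded matrices, with an explicit constant. It will show that a
  fixed summand next to a Gram matrix of order \<open>n\<close> hardly moves the scaled
  determinant.\<close>

lemma abs_det_diff_le:
  fixes A B :: "real mat"
  assumes A: "A \<in> carrier_mat k k" "norm_bound A b" and B: "B \<in> carrier_mat k k" "norm_bound B b"
    and e: "\<And>i l. i < k \<Longrightarrow> l < k \<Longrightarrow> \<bar>A $$ (i, l) - B $$ (i, l)\<bar> \<le> e" and b: "1 \<le> b"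
  shows "\<bar>det A - det B\<bar> \<le> fact k * (real k * b ^ k * e)"
proof -
  have "\<bar>det A - det B\<bar> \<le> (\<Sum>q | q permutes {0..<k}.
      \<bar>signof q * ((\<Prod>i = 0..<k. A $$ (i, q i)) - (\<Prod>i = 0..<k. B $$ (i, q i)))\<bar>)"
    unfolding det_def'[OF A(1)] det_def'[OF B(1)] sum_subtractf[symmetric] right_diff_distrib[symmetric]
    by (rule sum_abs)
  also have "\<dots> \<le> (\<Sum>q | q permutes {0..<k}. real k * b ^ k * e)"
  proof (rule sum_mono, clarify)
    fix q assume q: "q permutes {0..<k}"
    have "\<bar>signof q * ((\<Prod>i = 0..<k. A $$ (i, q i)) - (\<Prod>i = 0..<k. B $$ (i, q i)))\<bar>
        = \<bar>(\<Prod>i = 0..<k. A $$ (i, q i)) - (\<Prod>i = 0..<k. B $$ (i, q i))\<bar>"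
      by (simp add: abs_mult sign_def)
    also have "\<dots> \<le> real (card {0..<k}) * b ^ card {0..<k} * e"
      using permutes_in_image[OF q] norm_bound_realD[OF A(2,1)] norm_bound_realD[OF B(2,1)] e b
      by (intro abs_prod_diff_le) auto
    finally show "\<bar>signof q * ((\<Prod>i = 0..<k. A $$ (i, q i)) - (\<Prod>i = 0..<k. B $$ (i, q i)))\<bar>
        \<le> real k * b ^ k * e" by simp
  qed
  also have "\<dots> = fact k * (real k * b ^ k * e)" by (simp add: card_permutations[where n=k])
  finally show ?thesis .
qed

lemma abs_bilinear_le:
  fixes A :: "real mat"
  assumes A: "A \<in> carrier_mat k k" "norm_bound A a" and u: "u \<in> carrier_vec k" "\<And>i. i < k \<Longrightarrow> \<bar>u $ i\<bar> \<le> b"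
    and v: "v \<in> carrier_vec k" "\<And>i. i < k \<Longrightarrow> \<bar>v $ i\<bar> \<le> d"
  shows "\<bar>u \<bullet> (A *\<^sub>v v)\<bar> \<le> (real k)\<^sup>2 * a * b * d"
proof -
  have "u \<bullet> (A *\<^sub>v v) = (\<Sum>i<k. \<Sum>l<k. u $ i * A $$ (i,l) * v $ l)"
    using A u v by (auto simp: scalar_prod_def sum_distrib_left mult.assoc lessThan_atLeast0 intro!: sum.cong)
  also have "\<bar>\<dots>\<bar> \<le> (\<Sum>i<k. \<Sum>l<k. \<bar>u $ i * A $$ (i,l) * v $ l\<bar>)"
    by (intro order_trans[OF sum_abs] sum_mono) auto
  also have "\<dots> \<le> (\<Sum>i<k. \<Sum>l<k. b * a * d)"
  proof (intro sum_mono)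
    fix i l assume "i \<in> {..<k}" "l \<in> {..<k}"
    then have "\<bar>u $ i\<bar> \<le> b" "\<bar>A $$ (i,l)\<bar> \<le> a" "\<bar>v $ l\<bar> \<le> d"
      using u(2) v(2) norm_bound_realD[OF A(2,1)] by auto
    then show "\<bar>u $ i * A $$ (i, l) * v $ l\<bar> \<le> b * a * d"
      unfolding abs_mult by (intro mult_mono) (auto intro: order_trans[OF abs_ge_zero] mult_nonneg_nonneg)
  qed
  also have "\<dots> = (real k)\<^sup>2 * a * b * d" by (simp add: power2_eq_square)
  finally show ?thesis .
qed

section \<open>Designs with bounded Gram determinants\<close>

lemma pick_less:
  assumes "j \<subseteq> {..<p}" "l < card j"
  shows "pick j l < p"
  using pick_in_set_le[OF assms(2)] assms(1) by auto

lemma Xsub_carrier: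
  assumes "A \<in> carrier_mat n p" "j \<subseteq> {..<p}"
  shows "Xsub A j \<in> carrier_mat n (card j)"
proof -
  have "{i. i < p \<and> i \<in> j} = j" using assms(2) by auto
  then show ?thesis using assms(1) unfolding Xsub_def carrier_mat_def by (simp add: dim_submatrix)
qed

lemma col_Xsub:
  assumes A: "A \<in> carrier_mat n p" and j: "j \<subseteq> {..<p}" and l: "l < card j"
  shows "col (Xsub A j) l = col A (pick j l)"
proof -
  have "{i. i < p \<and> i \<in> j} = j" using j by auto
  then have "Xsub A j $$ (i, l) = A $$ (i, pick j l)" if "i < n" for i
    using A l that submatrix_index[of i A UNIV l j] by (simp add: Xsub_def pick_UNIV)
  then show ?thesis using Xsub_carrier[OF A j] A pick_less[OF j l] l by (intro eq_vecI) auto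
qed

lemma Xsub_transpose_mult_vec_index:
  assumes "A \<in> carrier_mat n p" "j \<subseteq> {..<p}" "l < card j" "v \<in> carrier_vec n"
  shows "(transpose_mat (Xsub A j) *\<^sub>v v) $ l = col A (pick j l) \<bullet> v"
  using Xsub_carrier[OF assms(1,2)] assms by (simp add: col_Xsub)

lemma gram_carrier:
  assumes "A \<in> carrier_mat n p" "j \<subseteq> {..<p}"
  shows "gram A j \<in> carrier_mat (card j) (card j)"
  using Xsub_carrier[OF assms] unfolding gram_def by auto

lemma gram_index:
  assumes "A \<in> carrier_mat n p" "j \<subseteq> {..<p}" "k < card j" "l < card j"
  shows "gram A j $$ (k, l) = col A (pick j k) \<bullet> col A (pick j l)"
  using Xsub_carrier[OF assms(1,2)] assms unfolding gram_def by (simp add: col_Xsub)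

lemma gram_symmetric:
  assumes "A \<in> carrier_mat n p" "j \<subseteq> {..<p}"
  shows "transpose_mat (gram A j) = gram A j"
  using Xsub_carrier[OF assms] unfolding gram_def by (subst transpose_mult[of _ "card j" n]) auto

text \<open>The arithmetic-geometric mean inequality in each coordinate. It replaces Cauchy-Schwarz
  without square roots, at no cost when both squared norms have the same bound.\<close>

lemma abs_scalar_prod_le:
  fixes u v :: "real vec"
  assumes "dim_vec u = dim_vec v"
  shows "\<bar>u \<bullet> v\<bar> \<le> (u \<bullet> u + v \<bullet> v) / 2"
proof -
  have "\<bar>u \<bullet> v\<bar> \<le> (\<Sum>i = 0..<dim_vec v. \<bar>u $ i * v $ i\<bar>)"
    unfolding scalar_prod_def by (rule sum_abs)
  also have "\<dots> \<le> (\<Sum>i = 0..<dim_vec v. (u $ i * u $ i + v $ i * v $ i) / 2)"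
  proof (rule sum_mono)
    fix i show "\<bar>u $ i * v $ i\<bar> \<le> (u $ i * u $ i + v $ i * v $ i) / 2"
      using sum_squares_bound[of "\<bar>u $ i\<bar>" "\<bar>v $ i\<bar>"] by (simp add: abs_mult power2_eq_square)
  qed
  also have "\<dots> = (u \<bullet> u + v \<bullet> v) / 2"
    using assms by (simp add: scalar_prod_def sum.distrib sum_divide_distrib[symmetric])
  finally show ?thesis .
qed

text \<open>The limits inferior and superior in (A2) are encoded by constants that bound the
  determinants from some \<open>n\<close> on, for all models together.\<close>

locale regression_design =
  fixes X :: "nat \<Rightarrow> real mat" and p :: nat and c C :: real
  assumes X_carrier: "\<And>n. X n \<in> carrier_mat n p"
    and c_pos: "0 < c"
    and det_lower: "\<forall>\<^sub>F n in sequentially. \<forall>j. j \<subseteq> {..<p} \<longrightarrow> c \<le> det ((1 / real n) \<cdot>\<^sub>m gram (X n) j)"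
    and det_upper: "\<forall>\<^sub>F n in sequentially. \<forall>j. j \<subseteq> {..<p} \<longrightarrow> det ((1 / real n) \<cdot>\<^sub>m gram (X n) j) \<le> C"
begin

lemmas Xsub_X_carrier = Xsub_carrier[OF X_carrier]
lemmas gram_X_carrier = gram_carrier[OF X_carrier]

text \<open>Both bounds hold together at some \<open>n\<close>; any model, here the empty one, then
  gives \<open>c \<le> C\<close>.\<close>

lemma C_pos: "0 < C"
proof -
  from eventually_happens[OF eventually_conj[OF det_lower det_upper]]
  show ?thesis using c_pos by (force dest!: spec[of _ "{}"])
qed

text \<open>The Gram matrix of a one-column model is 1 by 1, so (A2) for singletons bounds the
  squared column norms; mixed products follow from \<open>abs_scalar_prod_le\<close>.\<close>

lemma col_col_le:
  "\<forall>\<^sub>F n in sequentially. \<forall>a < p. \<forall>b < p. \<bar>col (X n) a \<bullet> col (X n) b\<bar> \<le> C * real n"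
  using det_upper eventually_gt_at_top[of 0]
proof eventually_elim
  case (elim n)
  have self: "col (X n) a \<bullet> col (X n) a \<le> C * real n" if a: "a < p" for a
  proof -
    have j: "{a} \<subseteq> {..<p}" using a by auto
    \<comment> \<open>\<open>pick\<close> counts positions from 0 and is computed by
      \<open>LEAST\<close>.\<close>
    have "(LEAST b. b = a) = a" by (rule Least_equality) auto
    then have "pick {a} 0 = a" by simp
    then have "det ((1 / real n) \<cdot>\<^sub>m gram (X n) {a}) = (1 / real n) * (col (X n) a \<bullet> col (X n) a)"
      using gram_X_carrier[OF j, of n] gram_index[OF X_carrier[of n] j, of 0 0]
      by (subst det_single) simp_all
    then have "(1 / real n) * (col (X n) a \<bullet> col (X n) a) \<le> C" using elim(1) j by auto
    then show ?thesis using elim(2) by (simp add: field_simps)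
  qed
  show ?case
  proof (intro allI impI)
    fix a b assume "a < p" "b < p"
    then show "\<bar>col (X n) a \<bullet> col (X n) b\<bar> \<le> C * real n"
      using abs_scalar_prod_le[of "col (X n) a" "col (X n) b"] self[of a] self[of b] by simp
  qed
qed

context
  fixes j :: "nat set" and R :: "real mat"
  assumes j: "j \<subseteq> {..<p}" and R: "R \<in> carrier_mat (card j) (card j)"
begin

text \<open>The fixed matrix \<open>R\<close> will be \<open>0\<close> for the hat matrix and
  \<open>minv (W j)\<close> for \<open>Amat\<close>; carrying it along treats both inverses at
  once.\<close>

abbreviation (input) "scaled n \<equiv> (1 / real n) \<cdot>\<^sub>m (gram (X n) j + R)"

lemma scaled_carrier: "scaled n \<in> carrier_mat (card j) (card j)"
  using R by auto

lemma norm_bound_scaled: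
  obtains b r where "1 \<le> b" "norm_bound R r" "\<forall>\<^sub>F n in sequentially. norm_bound (scaled n) b
    \<and> norm_bound ((1 / real n) \<cdot>\<^sub>m gram (X n) j) b"
proof -
  obtain r where r: "norm_bound R r" using norm_bound_max by blast
  \<comment> \<open>The summand 1 secures \<open>1 \<le> b\<close>, which the bound from Cramer's
    rule requires; \<open>C\<close> covers the scaled Gram entries, and \<open>\<bar>r\<bar>\<close>
    covers those of \<open>R\<close>, which division by \<open>n\<close> only shrinks.\<close>
  have "\<forall>\<^sub>F n in sequentially. norm_bound (scaled n) (1 + C + \<bar>r\<bar>) \<and>
     norm_bound ((1 / real n) \<cdot>\<^sub>m gram (X n) j) (1 + C + \<bar>r\<bar>)"
    using col_col_le eventually_ge_at_top[of 1]
  proof eventually_elim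
    case (elim n)
    have "\<bar>gram (X n) j $$ (k, l)\<bar> \<le> C * real n" if "k < card j" "l < card j" for k l
      using elim(1) pick_less[OF j] that gram_index[OF X_carrier j that] by auto
    then have 1: "\<bar>gram (X n) j $$ (k, l)\<bar> / real n \<le> C" if "k < card j" "l < card j" for k l
      using that elim(2) by (simp add: field_simps)
    have 2: "\<bar>R $$ (k, l)\<bar> / real n \<le> \<bar>r\<bar>" if "k < card j" "l < card j" for k l
    proof -
      have "\<bar>R $$ (k, l)\<bar> / real n \<le> \<bar>R $$ (k, l)\<bar> / 1" using elim(2) by (intro frac_le) auto
      also have "\<dots> \<le> \<bar>r\<bar>" using norm_bound_realD[OF r R that] by auto
      finally show ?thesis .
    qed
    have 3: "\<bar>(gram (X n) j $$ (k, l) + R $$ (k, l)) / real n\<bar> \<le> C + \<bar>r\<bar>"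
      if "k < card j" "l < card j" for k l
    proof -
      have "\<bar>(gram (X n) j $$ (k, l) + R $$ (k, l)) / real n\<bar>
         \<le> \<bar>gram (X n) j $$ (k, l)\<bar> / real n + \<bar>R $$ (k, l)\<bar> / real n"
        unfolding add_divide_distrib by (rule order_trans[OF abs_triangle_ineq]) simp
      then show ?thesis using 1[OF that] 2[OF that] by simp
    qed
    show ?case
    proof (intro conjI norm_boundI)
      fix k l assume "k < dim_row (scaled n)" "l < dim_col (scaled n)"
      then have kl: "k < card j" "l < card j" using R by auto
      show "norm (scaled n $$ (k, l)) \<le> 1 + C + \<bar>r\<bar>"
        using 3[OF kl] kl R gram_X_carrier[OF j, of n] by simp
    next
      fix k l assume "k < dim_row ((1 / real n) \<cdot>\<^sub>m gram (X n) j)" "l < dim_col ((1 / real n) \<cdot>\<^sub>m gram (X n) j)"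
      then have kl: "k < card j" "l < card j" using gram_X_carrier[OF j, of n] by auto
      show "norm (((1 / real n) \<cdot>\<^sub>m gram (X n) j) $$ (k, l)) \<le> 1 + C + \<bar>r\<bar>"
        using 1[OF kl] kl gram_X_carrier[OF j, of n] by simp
    qed
  qed
  moreover have "1 \<le> 1 + C + \<bar>r\<bar>" using C_pos by simp
  ultimately show ?thesis using r that by blast
qed

text \<open>\<open>R\<close> moves each entry of the scaled Gram matrix by at most
  \<open>\<bar>r\<bar> / real n\<close>, so the determinant eventually moves by less than
  \<open>c / 2\<close>: half of the lower bound in (A2) survives.\<close>

lemma det_scaled:
  "\<forall>\<^sub>F n in sequentially. c / 2 \<le> det (scaled n) \<and> det (scaled n) \<le> C + c / 2"
proof -
  obtain b r where b: "1 \<le> b" and r: "norm_bound R r"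
    and nb: "\<forall>\<^sub>F n in sequentially. norm_bound (scaled n) b
       \<and> norm_bound ((1 / real n) \<cdot>\<^sub>m gram (X n) j) b"
    using norm_bound_scaled by blast
  have "(\<lambda>n. fact (card j) * (real (card j) * b ^ card j * (\<bar>r\<bar> / real n))) \<longlonglongrightarrow>
     fact (card j) * (real (card j) * b ^ card j * 0)"
    by (intro tendsto_mult tendsto_const lim_const_over_n)
  then have "\<forall>\<^sub>F n in sequentially.
     fact (card j) * (real (card j) * b ^ card j * (\<bar>r\<bar> / real n)) < c / 2"
    using c_pos by (intro order_tendstoD(2)) auto
  with nb det_lower det_upper eventually_gt_at_top[of 0] show ?thesis
  proof eventually_elim
    case (elim n)
    have "\<bar>det (scaled n) - det ((1 / real n) \<cdot>\<^sub>m gram (X n) j)\<bar>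
       \<le> fact (card j) * (real (card j) * b ^ card j * (\<bar>r\<bar> / real n))"
    proof (rule abs_det_diff_le[OF scaled_carrier _ _ _ _ b])
      show "norm_bound (scaled n) b" "norm_bound ((1 / real n) \<cdot>\<^sub>m gram (X n) j) b"
        using elim(1) by blast+
      show "(1 / real n) \<cdot>\<^sub>m gram (X n) j \<in> carrier_mat (card j) (card j)"
        using gram_X_carrier[OF j, of n] by simp
    next
      fix k l assume kl: "k < card j" "l < card j"
      have "scaled n $$ (k, l) - ((1 / real n) \<cdot>\<^sub>m gram (X n) j) $$ (k, l) = R $$ (k, l) / real n"
        using kl R gram_X_carrier[OF j, of n] by (simp add: add_divide_distrib)
      moreover have "\<bar>R $$ (k, l) / real n\<bar> \<le> \<bar>r\<bar> / real n"
        using norm_bound_realD[OF r R kl] by (simp add: divide_right_mono)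
      ultimately show "\<bar>scaled n $$ (k, l) - ((1 / real n) \<cdot>\<^sub>m gram (X n) j) $$ (k, l)\<bar> \<le> \<bar>r\<bar> / real n"
        by simp
    qed
    then have "\<bar>det (scaled n) - det ((1 / real n) \<cdot>\<^sub>m gram (X n) j)\<bar> < c / 2" using elim by linarith
    moreover have "c \<le> det ((1 / real n) \<cdot>\<^sub>m gram (X n) j)" "det ((1 / real n) \<cdot>\<^sub>m gram (X n) j) \<le> C"
      using elim j by auto
    ultimately show ?case by linarith
  qed
qed

text \<open>Cramer's rule is applied after scaling, where all bounds are independent of
  \<open>n\<close>; undoing the scaling produces the factor \<open>1 / n\<close>.\<close>

lemma minv_gram_plus:
  obtains K where "0 \<le> K" "\<forall>\<^sub>F n in sequentially. det (gram (X n) j + R) \<noteq> 0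
     \<and> norm_bound (minv (gram (X n) j + R)) (K / real n)"
proof -
  obtain b where b: "1 \<le> b" and nb: "\<forall>\<^sub>F n in sequentially. norm_bound (scaled n) b"
    using norm_bound_scaled by (auto simp: eventually_conj_iff)
  define K where "K = fact (card j) * b ^ card j / (c / 2)"
  have "\<forall>\<^sub>F n in sequentially. det (gram (X n) j + R) \<noteq> 0
     \<and> norm_bound (minv (gram (X n) j + R)) (K / real n)"
    using nb det_scaled eventually_gt_at_top[of 0]
  proof eventually_elim
    case (elim n)
    let ?S = "scaled n"
    have S: "?S \<in> carrier_mat (card j) (card j)" "det ?S \<noteq> 0" using R elim c_pos by auto
    have eq: "gram (X n) j + R = real n \<cdot>\<^sub>m ?S"
      using R gram_X_carrier[OF j, of n] elim(3) by (auto intro!: eq_matI)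
    have "norm_bound (minv ?S) K"
      unfolding K_def using elim b c_pos S by (intro norm_bound_minv) auto
    moreover have "minv (gram (X n) j + R) = (1 / real n) \<cdot>\<^sub>m minv ?S"
      using S elim(3) by (subst eq, intro minv_smult) auto
    ultimately have "norm_bound (minv (gram (X n) j + R)) (K / real n)"
      using elim(3) minv_inverts(1)[OF S]
      by (auto simp: norm_bound_def abs_mult divide_right_mono)
    moreover have "det (gram (X n) j + R) \<noteq> 0"
      using S(2) elim(3) by (subst eq) (simp only: det_smult, simp)
    ultimately show ?case by simp
  qed
  moreover have "0 \<le> K" unfolding K_def using b c_pos by auto
  ultimately show ?thesis using that by blast
qed

end

end

section \<open>Hat matrices and residual sums of squares\<close>

text \<open>The resolvent identity, from expanding \<open>minv G * (G + R) * minv (G + R)\<close> in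
  two ways. Its gain is that the difference carries two inverse factors, each of order
  \<open>1 / n\<close> for Gram matrices.\<close>

lemma minv_diff:
  fixes G R :: "real mat"
  assumes G: "G \<in> carrier_mat k k" "det G \<noteq> 0" and R: "R \<in> carrier_mat k k" and GR: "det (G + R) \<noteq> 0"
  shows "minv G - minv (G + R) = minv G * R * minv (G + R)"
proof -
  let ?H = "minv (G + R)"
  have GRc: "G + R \<in> carrier_mat k k" using R by auto
  note g = minv_inverts[OF G] and h = minv_inverts[OF GRc GR]
  have "minv G * (G + R) * ?H = minv G"
    using g h GRc by (simp add: assoc_mult_mat[OF g(1) GRc h(1)])
  moreover have "minv G * (G + R) * ?H = ?H + minv G * R * ?H"
    using g h G(1) R
    by (simp add: mult_add_distrib_mat[OF g(1) G(1) R] add_mult_distrib_mat[of _ k k])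
  ultimately have eq: "minv G = ?H + minv G * R * ?H" by simp
  show ?thesis using g h R by (subst (1) eq) (auto intro!: eq_matI simp del: index_mult_mat(1))
qed

text \<open>Moves a form on \<open>n\<close>-vectors to the fixed dimension \<open>k\<close>, where
  entrywise bounds cost no factor growing with \<open>n\<close>.\<close>

lemma scalar_prod_sandwich:
  fixes Z M :: "real mat"
  assumes Z: "Z \<in> carrier_mat n k" and M: "M \<in> carrier_mat k k"
    and u: "u \<in> carrier_vec n" and v: "v \<in> carrier_vec n"
  shows "u \<bullet> ((Z * M * transpose_mat Z) *\<^sub>v v) = (transpose_mat Z *\<^sub>v u) \<bullet> (M *\<^sub>v (transpose_mat Z *\<^sub>v v))"
proof -
  have "(Z * M * transpose_mat Z) *\<^sub>v v = Z *\<^sub>v (M *\<^sub>v (transpose_mat Z *\<^sub>v v))"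
    using assms by (simp add: assoc_mult_mat_vec[of _ n k _ n] assoc_mult_mat_vec[of Z n k M k])
  then show ?thesis
    using transpose_vec_mult_scalar[OF Z, of "M *\<^sub>v (transpose_mat Z *\<^sub>v v)" u] assms
      comm_scalar_prod[of "M *\<^sub>v (transpose_mat Z *\<^sub>v v)" k "transpose_mat Z *\<^sub>v u"]
      comm_scalar_prod[of "Z *\<^sub>v (M *\<^sub>v (transpose_mat Z *\<^sub>v v))" n u]
    by simp
qed

section \<open>The hat matrix as an orthogonal projection\<close>

context
  fixes A :: "real mat" and n p :: nat and j :: "nat set"
  assumes A: "A \<in> carrier_mat n p" and j: "j \<subseteq> {..<p}" and det: "det (gram A j) \<noteq> 0"
begin

private lemmas Z = Xsub_carrier[OF A j]
private lemmas G = gram_carrier[OF A j]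
private lemmas Gi = minv_inverts[OF G det]

lemma hat_carrier: "hat A j \<in> carrier_mat n n"
  using Z Gi unfolding hat_def by auto

lemma hat_scalar_prod:
  assumes "u \<in> carrier_vec n" "v \<in> carrier_vec n"
  shows "u \<bullet> (hat A j *\<^sub>v v)
    = (transpose_mat (Xsub A j) *\<^sub>v u) \<bullet> (minv (gram A j) *\<^sub>v (transpose_mat (Xsub A j) *\<^sub>v v))"
  unfolding hat_def using scalar_prod_sandwich[OF Z Gi(1) assms] .

lemma hat_self_adjoint:
  assumes u: "u \<in> carrier_vec n" and v: "v \<in> carrier_vec n"
  shows "u \<bullet> (hat A j *\<^sub>v v) = (hat A j *\<^sub>v u) \<bullet> v"
proof -
  let ?Z = "Xsub A j" and ?M = "minv (gram A j)"
  have M: "transpose_mat ?M = ?M"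
    using minv_transpose[OF G det] gram_symmetric[OF A j] by simp
  have "transpose_mat (hat A j) = transpose_mat (transpose_mat ?Z) * transpose_mat (?Z * ?M)"
    unfolding hat_def using Z Gi by (intro transpose_mult) auto
  also have "\<dots> = ?Z * (transpose_mat ?M * transpose_mat ?Z)"
    using Z Gi by (subst transpose_mult[of _ n "card j"]) auto
  also have "\<dots> = hat A j" unfolding hat_def M using Z Gi by (simp add: assoc_mult_mat[of _ n "card j" _ "card j"])
  finally have "transpose_mat (hat A j) = hat A j" .
  then show ?thesis using transpose_vec_mult_scalar[OF hat_carrier v u] by simp
qed

lemma hat_Xsub: "hat A j * Xsub A j = Xsub A j"
proof -
  let ?Z = "Xsub A j" and ?M = "minv (gram A j)"
  have "hat A j * ?Z = ?Z * ?M * (transpose_mat ?Z * ?Z)"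
    unfolding hat_def using Z Gi by (intro assoc_mult_mat) auto
  also have "\<dots> = ?Z * (?M * gram A j)"
    unfolding gram_def[symmetric] using Z Gi G by (intro assoc_mult_mat) auto
  finally show ?thesis using Gi Z by simp
qed

lemma hat_idem:
  assumes v: "v \<in> carrier_vec n"
  shows "hat A j *\<^sub>v (hat A j *\<^sub>v v) = hat A j *\<^sub>v v"
proof -
  let ?Z = "Xsub A j" and ?M = "minv (gram A j)"
  have "hat A j * hat A j = hat A j * (?Z * (?M * transpose_mat ?Z))"
    unfolding hat_def using Z Gi by (simp add: assoc_mult_mat[of _ n "card j" _ "card j"])
  also have "\<dots> = hat A j * ?Z * (?M * transpose_mat ?Z)"
    using Z Gi hat_carrier by (intro assoc_mult_mat[symmetric]) auto
  also have "\<dots> = hat A j"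
    unfolding hat_Xsub using Z Gi by (simp add: hat_def assoc_mult_mat[of _ n "card j" _ "card j"])
  finally have "hat A j * hat A j = hat A j" .
  then show ?thesis using assoc_mult_mat_vec[OF hat_carrier hat_carrier v] by simp
qed

text \<open>Each column of the submodel is also a column of \<open>Xsub A j\<close>, and the
  projection fixes those.\<close>

lemma hat_fixes_submodel:
  assumes i: "i \<subseteq> j" and b: "b \<in> carrier_vec (card i)"
  shows "hat A j *\<^sub>v (Xsub A i *\<^sub>v b) = Xsub A i *\<^sub>v b"
proof -
  have ip: "i \<subseteq> {..<p}" using i j by auto
  note Zi = Xsub_carrier[OF A ip]
  have finj: "finite j" using j finite_subset by auto
  have "hat A j * Xsub A i = Xsub A i"
  proof (rule mat_col_eqI)
    fix l assume "l < dim_col (Xsub A i)"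
    then have l: "l < card i" using Zi by auto
    let ?a = "pick i l"
    have aj: "?a \<in> j" using pick_in_set_le[OF l] i by auto
    \<comment> \<open>The position of \<open>?a\<close> in \<open>j\<close> is the number of smaller
      elements of \<open>j\<close>, positions being counted from 0.\<close>
    define m where "m = card {b \<in> j. b < ?a}"
    have m: "m < card j" unfolding m_def using aj finj by (intro psubset_card_mono) auto
    have "pick j m = ?a" unfolding m_def by (rule pick_card_in_set[OF aj])
    then have eq: "col (Xsub A i) l = col (Xsub A j) m"
      using col_Xsub[OF A ip l] col_Xsub[OF A j m] by simp
    have "col (hat A j * Xsub A i) l = hat A j *\<^sub>v col (Xsub A j) m"
      using hat_carrier Zi l eq by (subst col_mult2) auto
    also have "\<dots> = col (hat A j * Xsub A j) m"
      using hat_carrier Z m by (subst col_mult2) auto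
    finally show "col (hat A j * Xsub A i) l = col (Xsub A i) l" unfolding hat_Xsub eq .
  qed (use hat_carrier Zi in auto)
  then show ?thesis using assoc_mult_mat_vec[OF hat_carrier Zi b] by simp
qed

lemma rss_eq:
  assumes y: "y \<in> carrier_vec n"
  shows "rss A y j = y \<bullet> y - y \<bullet> (hat A j *\<^sub>v y)"
  unfolding rss_def using A y hat_carrier
  by (simp add: minus_mult_distrib_mat_vec[of _ n n] scalar_prod_minus_distrib[of _ n])

text \<open>Self-adjointness and idempotence turn the part of the mean into its squared distance
  from the column space, the quantity that (A3) bounds below.\<close>

lemma rss_add:
  assumes m: "m \<in> carrier_vec n" and e: "e \<in> carrier_vec n"
  shows "rss A (m + e) j = (m - hat A j *\<^sub>v m) \<bullet> (m - hat A j *\<^sub>v m)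
    + 2 * (m \<bullet> e - m \<bullet> (hat A j *\<^sub>v e)) + e \<bullet> e - e \<bullet> (hat A j *\<^sub>v e)"
proof -
  let ?h = "\<lambda>v. hat A j *\<^sub>v v"
  have c: "?h m \<in> carrier_vec n" "?h e \<in> carrier_vec n" using hat_carrier m e by auto
  have "?h m \<bullet> ?h m = m \<bullet> ?h m"
    using hat_self_adjoint[OF m c(1)] hat_idem[OF m] by simp
  moreover have "?h m \<bullet> m = m \<bullet> ?h m" using hat_self_adjoint[OF m m] by simp
  moreover have "e \<bullet> ?h m = m \<bullet> ?h e"
    using hat_self_adjoint[OF m e] comm_scalar_prod[OF e c(1)] by simp
  moreover have "e \<bullet> m = m \<bullet> e" using comm_scalar_prod[OF e m] .
  ultimately show ?thesis
    using m e c hat_carrier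
    by (simp add: rss_eq mult_add_distrib_mat_vec[of _ n n] scalar_prod_add_distrib[of _ n]
        add_scalar_prod_distrib[of _ n] scalar_prod_minus_distrib[of _ n] minus_scalar_prod_distrib[of _ n])
qed

text \<open>The mean lies in the range of the projection, so its distance and the cross terms vanish
  and only noise remains.\<close>

lemma rss_add_submodel:
  assumes "i \<subseteq> j" "b \<in> carrier_vec (card i)" and e: "e \<in> carrier_vec n"
  shows "rss A (Xsub A i *\<^sub>v b + e) j = e \<bullet> e - e \<bullet> (hat A j *\<^sub>v e)"
proof -
  let ?m = "Xsub A i *\<^sub>v b"
  have "i \<subseteq> {..<p}" using assms(1) j by auto
  from Xsub_carrier[OF A this] have m: "?m \<in> carrier_vec n" using assms(2) by simp
  have h: "hat A j *\<^sub>v ?m = ?m" using hat_fixes_submodel assms by simp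
  have "?m \<bullet> (hat A j *\<^sub>v e) = ?m \<bullet> e" using hat_self_adjoint[OF m e] h by simp
  then show ?thesis using rss_add[OF m e] h m by simp
qed

end

section \<open>Uniform bounds for a sequence of designs\<close>

lemma abs_scalar_prod_le_sum:
  fixes u v :: "real vec"
  assumes "dim_vec u = k" "dim_vec v = k" "\<And>i. i < k \<Longrightarrow> \<bar>v $ i\<bar> \<le> b"
  shows "\<bar>u \<bullet> v\<bar> \<le> (\<Sum>i<k. \<bar>u $ i\<bar>) * b"
proof -
  have "\<bar>u \<bullet> v\<bar> \<le> (\<Sum>i<k. \<bar>u $ i * v $ i\<bar>)"
    using assms(1,2) unfolding scalar_prod_def by (simp add: lessThan_atLeast0 sum_abs)
  also have "\<dots> \<le> (\<Sum>i<k. \<bar>u $ i\<bar> * b)"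
    using assms(3) by (intro sum_mono) (auto simp: abs_mult intro: mult_left_mono)
  finally show ?thesis by (simp add: sum_distrib_right)
qed

lemma pos_def_mat_det_nonzero:
  assumes "pos_def_mat k V"
  shows "det V \<noteq> 0"
proof
  assume "det V = 0"
  moreover have V: "V \<in> carrier_mat k k" using assms unfolding pos_def_mat_def by auto
  ultimately obtain x where "x \<in> carrier_vec k" "x \<noteq> 0\<^sub>v k" "V *\<^sub>v x = 0\<^sub>v k"
    using det_0_iff_vec_prod_zero[OF V] by auto
  then show False using assms unfolding pos_def_mat_def by force
qed

context regression_design
begin

lemma sandwich_bound:
  assumes j: "j \<subseteq> {..<p}" and M: "M \<in> carrier_mat (card j) (card j)" "norm_bound M a"
    and u: "u \<in> carrier_vec n" "\<And>i. i < p \<Longrightarrow> \<bar>col (X n) i \<bullet> u\<bar> \<le> b"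
    and v: "v \<in> carrier_vec n" "\<And>i. i < p \<Longrightarrow> \<bar>col (X n) i \<bullet> v\<bar> \<le> d"
  shows "\<bar>(transpose_mat (Xsub (X n) j) *\<^sub>v u) \<bullet> (M *\<^sub>v (transpose_mat (Xsub (X n) j) *\<^sub>v v))\<bar>
    \<le> (real (card j))\<^sup>2 * a * b * d"
proof (rule abs_bilinear_le[OF M])
  show "transpose_mat (Xsub (X n) j) *\<^sub>v u \<in> carrier_vec (card j)"
    "transpose_mat (Xsub (X n) j) *\<^sub>v v \<in> carrier_vec (card j)"
    using Xsub_X_carrier[OF j, of n] u v by auto
  fix i assume i: "i < card j"
  show "\<bar>(transpose_mat (Xsub (X n) j) *\<^sub>v u) $ i\<bar> \<le> b"
    unfolding Xsub_transpose_mult_vec_index[OF X_carrier j i u(1)] by (rule u(2)[OF pick_less[OF j i]])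
  show "\<bar>(transpose_mat (Xsub (X n) j) *\<^sub>v v) $ i\<bar> \<le> d"
    unfolding Xsub_transpose_mult_vec_index[OF X_carrier j i v(1)] by (rule v(2)[OF pick_less[OF j i]])
qed

lemma gram_invertible:
  assumes "j \<subseteq> {..<p}"
  shows "\<forall>\<^sub>F n in sequentially. det (gram (X n) j) \<noteq> 0"
  using minv_gram_plus[OF assms zero_carrier_mat] gram_X_carrier[OF assms]
  by (auto simp: eventually_conj_iff)

text \<open>Two column bounds meet an inverse of order \<open>1 / n\<close>. Noise on both sides
  gives a bounded value, mean against noise gives order \<open>sqrt n\<close>, the full response on
  both sides gives order \<open>n\<close>.\<close>

lemma hat_bilinear_bound:
  assumes j: "j \<subseteq> {..<p}"
  obtains K where "0 \<le> K" "\<forall>\<^sub>F n in sequentially. \<forall>u \<in> carrier_vec n. \<forall>v \<in> carrier_vec n. \<forall>b d.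
    (\<forall>i<p. \<bar>col (X n) i \<bullet> u\<bar> \<le> b) \<longrightarrow> (\<forall>i<p. \<bar>col (X n) i \<bullet> v\<bar> \<le> d) \<longrightarrow>
    \<bar>u \<bullet> (hat (X n) j *\<^sub>v v)\<bar> \<le> K * b * d / real n"
proof -
  obtain K where K: "0 \<le> K" "\<forall>\<^sub>F n in sequentially. det (gram (X n) j + 0\<^sub>m (card j) (card j)) \<noteq> 0
     \<and> norm_bound (minv (gram (X n) j + 0\<^sub>m (card j) (card j))) (K / real n)"
    by (rule minv_gram_plus[OF j zero_carrier_mat])
  have "\<forall>\<^sub>F n in sequentially. \<forall>u \<in> carrier_vec n. \<forall>v \<in> carrier_vec n. \<forall>b d.
    (\<forall>i<p. \<bar>col (X n) i \<bullet> u\<bar> \<le> b) \<longrightarrow> (\<forall>i<p. \<bar>col (X n) i \<bullet> v\<bar> \<le> d) \<longrightarrow>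
    \<bar>u \<bullet> (hat (X n) j *\<^sub>v v)\<bar> \<le> ((real (card j))\<^sup>2 * K) * b * d / real n"
    using K(2)
  proof eventually_elim
    case (elim n)
    have G: "gram (X n) j + 0\<^sub>m (card j) (card j) = gram (X n) j" using gram_X_carrier[OF j, of n] by simp
    have d: "det (gram (X n) j) \<noteq> 0" and nb: "norm_bound (minv (gram (X n) j)) (K / real n)"
      using elim unfolding G by auto
    show ?case
    proof (intro ballI allI impI)
      fix u v b d assume "u \<in> carrier_vec n" "v \<in> carrier_vec n"
        "\<forall>i<p. \<bar>col (X n) i \<bullet> u\<bar> \<le> b" "\<forall>i<p. \<bar>col (X n) i \<bullet> v\<bar> \<le> d"
      then show "\<bar>u \<bullet> (hat (X n) j *\<^sub>v v)\<bar> \<le> ((real (card j))\<^sup>2 * K) * b * d / real n"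
        using sandwich_bound[OF j minv_inverts(1)[OF gram_X_carrier[OF j] d] nb, where u = u and b = b and v = v and d = d]
          hat_scalar_prod[OF X_carrier j d, of u v] by simp
    qed
  qed
  with K(1) that[of "(real (card j))\<^sup>2 * K"] show ?thesis by auto
qed

text \<open>\<open>Amat\<close> and the residual projection differ only in the inverse, and
  \<open>minv_diff\<close> makes that difference of order \<open>1 / n^2\<close>. Even for column
  products of order \<open>n\<close> the two quadratic forms thus differ by a bounded
  amount.\<close>

lemma Amat_bound:
  assumes j: "j \<subseteq> {..<p}" and W: "pos_def_mat (card j) (W j)"
  obtains K where "0 \<le> K" "\<forall>\<^sub>F n in sequentially. \<forall>y \<in> carrier_vec n. \<forall>b.
    (\<forall>i<p. \<bar>col (X n) i \<bullet> y\<bar> \<le> b) \<longrightarrow>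
    \<bar>y \<bullet> (Amat W (X n) j *\<^sub>v y) - rss (X n) y j\<bar> \<le> K * b\<^sup>2 / (real n)\<^sup>2"
proof -
  have Wc: "W j \<in> carrier_mat (card j) (card j)" using W unfolding pos_def_mat_def by auto
  note R = minv_inverts(1)[OF Wc pos_def_mat_det_nonzero[OF W]]
  obtain r where r: "norm_bound (minv (W j)) r" using norm_bound_max by blast
  obtain K where K: "\<forall>\<^sub>F n in sequentially. det (gram (X n) j + 0\<^sub>m (card j) (card j)) \<noteq> 0
     \<and> norm_bound (minv (gram (X n) j + 0\<^sub>m (card j) (card j))) (K / real n)"
    using minv_gram_plus[OF j zero_carrier_mat] by blast
  obtain K' where K': "\<forall>\<^sub>F n in sequentially. det (gram (X n) j + minv (W j)) \<noteq> 0
     \<and> norm_bound (minv (gram (X n) j + minv (W j))) (K' / real n)"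
    using minv_gram_plus[OF j R] by blast
  \<comment> \<open>The two single factors \<open>real (card j)\<close> stem from the two matrix
    products in \<open>minv_diff\<close>. The absolute value taken below avoids any discussion of
    the signs of \<open>K\<close>, \<open>K'\<close> and \<open>r\<close>.\<close>
  let ?L = "(real (card j))\<^sup>2 * (K * r * real (card j) * K' * real (card j))"
  have "\<forall>\<^sub>F n in sequentially. \<forall>y \<in> carrier_vec n. \<forall>b.
    (\<forall>i<p. \<bar>col (X n) i \<bullet> y\<bar> \<le> b) \<longrightarrow>
    \<bar>y \<bullet> (Amat W (X n) j *\<^sub>v y) - rss (X n) y j\<bar> \<le> \<bar>?L\<bar> * b\<^sup>2 / (real n)\<^sup>2"
    using K K'
  proof eventually_elim
    case (elim n)
    let ?G = "gram (X n) j" and ?R = "minv (W j)" and ?Z = "Xsub (X n) j"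
    have G0: "?G + 0\<^sub>m (card j) (card j) = ?G" using gram_X_carrier[OF j, of n] by simp
    have d: "det ?G \<noteq> 0" and nb: "norm_bound (minv ?G) (K / real n)"
      using elim(1) unfolding G0 by auto
    have dR: "det (?G + ?R) \<noteq> 0" and nbR: "norm_bound (minv (?G + ?R)) (K' / real n)"
      using elim(2) by auto
    have GRc: "?G + ?R \<in> carrier_mat (card j) (card j)" using R by auto
    note g = minv_inverts(1)[OF gram_X_carrier[OF j] d] and h = minv_inverts(1)[OF GRc dR]
    note Z = Xsub_X_carrier[OF j, of n]
    have nbp: "norm_bound (minv ?G * ?R * minv (?G + ?R)) (K / real n * r * real (card j) * (K' / real n) * real (card j))"
      by (intro norm_bound_mult[of _ "card j" "card j" _ "card j"] mult_carrier_mat[OF g R] nb nbR r g R h)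
    show ?case
    proof (intro ballI allI impI)
      fix y b assume y: "y \<in> carrier_vec n" and b: "\<forall>i<p. \<bar>col (X n) i \<bullet> y\<bar> \<le> b"
      let ?z = "transpose_mat ?Z *\<^sub>v y"
      have z: "?z \<in> carrier_vec (card j)" using Z y by auto
      have "?Z * minv (?G + ?R) * transpose_mat ?Z \<in> carrier_mat n n" using Z h by auto
      then have "y \<bullet> (Amat W (X n) j *\<^sub>v y) = y \<bullet> y - ?z \<bullet> (minv (?G + ?R) *\<^sub>v ?z)"
        unfolding Amat_def using scalar_prod_sandwich[OF Z h y y] y X_carrier[of n]
        by (simp add: minus_mult_distrib_mat_vec[of _ n n] scalar_prod_minus_distrib[of _ n])
      moreover have "rss (X n) y j = y \<bullet> y - ?z \<bullet> (minv ?G *\<^sub>v ?z)"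
        using rss_eq[OF X_carrier j d y] hat_scalar_prod[OF X_carrier j d y y] by simp
      ultimately have "y \<bullet> (Amat W (X n) j *\<^sub>v y) - rss (X n) y j
        = ?z \<bullet> ((minv ?G - minv (?G + ?R)) *\<^sub>v ?z)"
        using z g h by (simp add: minus_mult_distrib_mat_vec[of _ "card j" "card j"]
            scalar_prod_minus_distrib[of _ "card j"])
      also have "\<dots> = ?z \<bullet> ((minv ?G * ?R * minv (?G + ?R)) *\<^sub>v ?z)"
        by (simp only: minv_diff[OF gram_X_carrier[OF j] d R dR])
      also have "\<bar>\<dots>\<bar> \<le> (real (card j))\<^sup>2 * (K / real n * r * real (card j) * (K' / real n) * real (card j)) * b * b"
        using b y g R h by (intro sandwich_bound[OF j _ nbp]) auto
      also have "\<dots> = ?L * (b\<^sup>2 / (real n)\<^sup>2)" by (simp add: power2_eq_square)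
      also have "\<dots> \<le> \<bar>?L\<bar> * (b\<^sup>2 / (real n)\<^sup>2)" by (intro mult_right_mono) auto
      finally show "\<bar>y \<bullet> (Amat W (X n) j *\<^sub>v y) - rss (X n) y j\<bar> \<le> \<bar>?L\<bar> * b\<^sup>2 / (real n)\<^sup>2" by simp
    qed
  qed
  with that[of "\<bar>?L\<bar>"] show ?thesis by auto
qed

end

section \<open>The mean vector and admissible noise\<close>

locale regression_model = regression_design +
  fixes jstar :: "nat set" and beta :: "real vec" and s c' :: real
  assumes jstar: "jstar \<subseteq> {..<p}"
    and beta: "beta \<in> carrier_vec (card jstar)"
    and s_pos: "0 < s" and c'_pos: "0 < c'"
    and separation: "\<forall>\<^sub>F n in sequentially. \<forall>j. j \<subseteq> {..<p} \<and> \<not> jstar \<subseteq> j \<longrightarrow>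
      (let mu = Xsub (X n) jstar *\<^sub>v beta; r = mu - hat (X n) j *\<^sub>v mu in (r \<bullet> r) / real n) \<ge> c'"
begin

definition mu :: "nat \<Rightarrow> real vec" where
  "mu n = Xsub (X n) jstar *\<^sub>v beta"

text \<open>\<open>s\<close> will be the error variance. Column products have standard deviation of
  order at most \<open>sqrt n\<close>, so \<open>L\<close> controls the probability of the first
  condition. The factors 1/2 and 2 are convenient constants on the two sides of 1, as
  \<open>e \<bullet> e\<close> concentrates near \<open>s * real n\<close>.\<close>

definition good :: "real \<Rightarrow> nat \<Rightarrow> real vec set" where
  "good L n = {e \<in> carrier_vec n. (\<forall>a<p. \<bar>col (X n) a \<bullet> e\<bar> \<le> L * sqrt (real n)) \<and>
     s / 2 * real n \<le> e \<bullet> e \<and> e \<bullet> e \<le> 2 * s * real n}"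

text \<open>The l1 norm, dual to the supremum bounds on column products.\<close>

definition beta_norm :: real where
  "beta_norm = (\<Sum>i<card jstar. \<bar>beta $ i\<bar>)"

lemma beta_norm_nonneg: "0 \<le> beta_norm"
  unfolding beta_norm_def by (intro sum_nonneg) auto

lemma mu_carrier: "mu n \<in> carrier_vec n"
  unfolding mu_def by (rule mult_mat_vec_carrier[OF Xsub_X_carrier[OF jstar] beta])

text \<open>Transposing the design matrix turns \<open>mu n \<bullet> v\<close> into the product of
  the fixed vector \<open>beta\<close> with column products of \<open>v\<close>.\<close>

lemma abs_mu_scalar_prod_le:
  assumes v: "v \<in> carrier_vec n" and b: "\<And>a. a < p \<Longrightarrow> \<bar>col (X n) a \<bullet> v\<bar> \<le> b"
  shows "\<bar>mu n \<bullet> v\<bar> \<le> beta_norm * b"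
proof -
  note Z = Xsub_X_carrier[OF jstar, of n]
  have "\<bar>beta \<bullet> (transpose_mat (Xsub (X n) jstar) *\<^sub>v v)\<bar> \<le> beta_norm * b"
    unfolding beta_norm_def
  proof (rule abs_scalar_prod_le_sum)
    fix i assume i: "i < card jstar"
    show "\<bar>(transpose_mat (Xsub (X n) jstar) *\<^sub>v v) $ i\<bar> \<le> b"
      unfolding Xsub_transpose_mult_vec_index[OF X_carrier jstar i v] by (rule b[OF pick_less[OF jstar i]])
  qed (use beta Z in auto)
  moreover have "mu n \<bullet> v = beta \<bullet> (transpose_mat (Xsub (X n) jstar) *\<^sub>v v)"
  proof -
    have "mu n \<bullet> v = v \<bullet> (Xsub (X n) jstar *\<^sub>v beta)"
      unfolding mu_def[symmetric] using comm_scalar_prod[OF mu_carrier v] .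
    also have "\<dots> = (transpose_mat (Xsub (X n) jstar) *\<^sub>v v) \<bullet> beta"
      using transpose_vec_mult_scalar[OF Z beta v] by simp
    also have "\<dots> = beta \<bullet> (transpose_mat (Xsub (X n) jstar) *\<^sub>v v)"
      using Z v beta by (intro comm_scalar_prod[of _ "card jstar"]) auto
    finally show ?thesis .
  qed
  ultimately show ?thesis by simp
qed

text \<open>\<open>abs_mu_scalar_prod_le\<close> is used twice: with a column as \<open>v\<close>,
  and then, by that result, with \<open>mu n\<close> itself.\<close>

lemma mu_bounds:
  "\<forall>\<^sub>F n in sequentially. (\<forall>a<p. \<bar>col (X n) a \<bullet> mu n\<bar> \<le> beta_norm * C * real n)
     \<and> mu n \<bullet> mu n \<le> beta_norm\<^sup>2 * C * real n"
  using col_col_le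
proof eventually_elim
  case (elim n)
  have 1: "\<bar>col (X n) a \<bullet> mu n\<bar> \<le> beta_norm * (C * real n)" if a: "a < p" for a
  proof -
    have ca: "col (X n) a \<in> carrier_vec n" using X_carrier[of n] by (intro carrier_vecI) simp
    have "\<bar>mu n \<bullet> col (X n) a\<bar> \<le> beta_norm * (C * real n)"
      using elim a by (intro abs_mu_scalar_prod_le[OF ca]) auto
    then show ?thesis using comm_scalar_prod[OF ca mu_carrier] by simp
  qed
  have "\<bar>mu n \<bullet> mu n\<bar> \<le> beta_norm * (beta_norm * (C * real n))"
    using 1 by (intro abs_mu_scalar_prod_le[OF mu_carrier]) auto
  then have 2: "mu n \<bullet> mu n \<le> beta_norm * (beta_norm * (C * real n))" by simp
  show ?case using 1 2 by (auto simp: power2_eq_square mult.assoc)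
qed

end

section \<open>Asymptotics of the residual sums of squares\<close>

context regression_model
begin

lemma mult_sqrt_mult_sqrt_divide:
  assumes "0 < n"
  shows "K * (b * sqrt (real n)) * (b * sqrt (real n)) / real n = K * b\<^sup>2"
proof -
  have "K * (b * sqrt (real n)) * (b * sqrt (real n)) = K * b\<^sup>2 * (sqrt (real n) * sqrt (real n))"
    by (simp only: power2_eq_square mult_ac)
  also have "\<dots> = K * b\<^sup>2 * real n" by simp
  finally have eq: "K * (b * sqrt (real n)) * (b * sqrt (real n)) = K * b\<^sup>2 * real n" .
  show ?thesis unfolding eq using assms by simp
qed

lemma goodD:
  assumes "e \<in> good L n"
  shows "e \<in> carrier_vec n" "\<And>a. a < p \<Longrightarrow> \<bar>col (X n) a \<bullet> e\<bar> \<le> L * sqrt (real n)"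
    "s / 2 * real n \<le> e \<bullet> e" "e \<bullet> e \<le> 2 * s * real n"
  using assms unfolding good_def by auto

lemma response_bound:
  assumes L: "0 \<le> L"
  shows "\<forall>\<^sub>F n in sequentially. \<forall>e \<in> good L n. mu n + e \<in> carrier_vec n
    \<and> (\<forall>a<p. \<bar>col (X n) a \<bullet> (mu n + e)\<bar> \<le> (beta_norm * C + L) * real n)"
  using mu_bounds eventually_ge_at_top[of 1]
proof eventually_elim
  case (elim n)
  show ?case
  proof (intro ballI conjI allI impI)
    fix e assume e: "e \<in> good L n"
    show "mu n + e \<in> carrier_vec n" using mu_carrier goodD(1)[OF e] by auto
    fix a assume a: "a < p"
    have ca: "col (X n) a \<in> carrier_vec n" using X_carrier[of n] by (intro carrier_vecI) simp
    have "1 * sqrt (real n) \<le> sqrt (real n) * sqrt (real n)" using elim(2) by (intro mult_right_mono) auto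
    then have "sqrt (real n) \<le> real n" by simp
    then have "L * sqrt (real n) \<le> L * real n" using L by (intro mult_left_mono)
    moreover have "\<bar>col (X n) a \<bullet> mu n\<bar> \<le> beta_norm * C * real n" using elim(1) a by auto
    ultimately show "\<bar>col (X n) a \<bullet> (mu n + e)\<bar> \<le> (beta_norm * C + L) * real n"
      using goodD(2)[OF e a] scalar_prod_add_distrib[OF ca mu_carrier goodD(1)[OF e]]
      unfolding abs_le_iff distrib_right by linarith
  qed
qed

text \<open>Next to \<open>e \<bullet> e\<close> only
  \<open>e \<bullet> (hat (X n) j *\<^sub>v e)\<close> is left, where two noise factors of order
  \<open>sqrt n\<close> meet an inverse of order \<open>1 / n\<close>.\<close>

lemma rss_correct:
  assumes j: "j \<subseteq> {..<p}" "jstar \<subseteq> j"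
  obtains K where "0 \<le> K" "\<forall>\<^sub>F n in sequentially. \<forall>e \<in> good L n. \<bar>rss (X n) (mu n + e) j - e \<bullet> e\<bar> \<le> K"
proof -
  obtain K where K: "0 \<le> K" "\<forall>\<^sub>F n in sequentially. \<forall>u \<in> carrier_vec n. \<forall>v \<in> carrier_vec n. \<forall>b d.
    (\<forall>i<p. \<bar>col (X n) i \<bullet> u\<bar> \<le> b) \<longrightarrow> (\<forall>i<p. \<bar>col (X n) i \<bullet> v\<bar> \<le> d) \<longrightarrow>
    \<bar>u \<bullet> (hat (X n) j *\<^sub>v v)\<bar> \<le> K * b * d / real n"
    by (rule hat_bilinear_bound[OF j(1)])
  have "\<forall>\<^sub>F n in sequentially. \<forall>e \<in> good L n. \<bar>rss (X n) (mu n + e) j - e \<bullet> e\<bar> \<le> K * L\<^sup>2"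
    using K(2) gram_invertible[OF j(1)] eventually_gt_at_top[of 0]
  proof eventually_elim
    case (elim n)
    show ?case
    proof
      fix e assume e: "e \<in> good L n"
      note ec = goodD(1)[OF e]
      have "\<bar>e \<bullet> (hat (X n) j *\<^sub>v e)\<bar> \<le> K * (L * sqrt (real n)) * (L * sqrt (real n)) / real n"
        using elim(1) ec goodD(2)[OF e] by blast
      also have "\<dots> = K * L\<^sup>2" using elim(3) by (rule mult_sqrt_mult_sqrt_divide)
      finally show "\<bar>rss (X n) (mu n + e) j - e \<bullet> e\<bar> \<le> K * L\<^sup>2"
        using rss_add_submodel[OF X_carrier j(1) elim(2) j(2) beta ec] unfolding mu_def by simp
    qed
  qed
  with K(1) that[of "K * L\<^sup>2"] show ?thesis by auto
qed

lemma rss_wrong: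
  assumes j: "j \<subseteq> {..<p}" "\<not> jstar \<subseteq> j" and L: "0 \<le> L"
  obtains K where "0 \<le> K" "\<forall>\<^sub>F n in sequentially. \<forall>e \<in> good L n.
    c' * real n + e \<bullet> e - K * sqrt (real n) \<le> rss (X n) (mu n + e) j"
proof -
  obtain K where K: "0 \<le> K" "\<forall>\<^sub>F n in sequentially. \<forall>u \<in> carrier_vec n. \<forall>v \<in> carrier_vec n. \<forall>b d.
    (\<forall>i<p. \<bar>col (X n) i \<bullet> u\<bar> \<le> b) \<longrightarrow> (\<forall>i<p. \<bar>col (X n) i \<bullet> v\<bar> \<le> d) \<longrightarrow>
    \<bar>u \<bullet> (hat (X n) j *\<^sub>v v)\<bar> \<le> K * b * d / real n"
    by (rule hat_bilinear_bound[OF j(1)])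
  \<comment> \<open>The summands bound the product of mean and noise, the same product through the
    hat matrix, and the projected noise; the last is bounded and only weakened to order
    \<open>sqrt n\<close>.\<close>
  let ?K = "2 * beta_norm * L + 2 * (K * (beta_norm * C) * L) + K * L\<^sup>2"
  have "\<forall>\<^sub>F n in sequentially. \<forall>e \<in> good L n.
    c' * real n + e \<bullet> e - ?K * sqrt (real n) \<le> rss (X n) (mu n + e) j"
    using K(2) gram_invertible[OF j(1)] eventually_ge_at_top[of 1] mu_bounds separation
  proof eventually_elim
    case (elim n)
    show ?case
    proof
      fix e assume e: "e \<in> good L n"
      note ec = goodD(1)[OF e]
      have n: "0 < real n" "1 \<le> sqrt (real n)" using elim(3) by auto
      have "\<bar>e \<bullet> (hat (X n) j *\<^sub>v e)\<bar> \<le> K * (L * sqrt (real n)) * (L * sqrt (real n)) / real n"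
        using elim(1) ec goodD(2)[OF e] by blast
      also have "\<dots> = K * L\<^sup>2" using n(1) by (intro mult_sqrt_mult_sqrt_divide) simp
      also have "\<dots> \<le> K * L\<^sup>2 * sqrt (real n)" using mult_left_mono[OF n(2), of "K * L\<^sup>2"] K(1) by simp
      finally have 1: "\<bar>e \<bullet> (hat (X n) j *\<^sub>v e)\<bar> \<le> K * L\<^sup>2 * sqrt (real n)" .
      have "\<bar>mu n \<bullet> (hat (X n) j *\<^sub>v e)\<bar> \<le> K * (beta_norm * C * real n) * (L * sqrt (real n)) / real n"
        using elim(1,4) ec mu_carrier goodD(2)[OF e] by blast
      also have "\<dots> = K * (beta_norm * C) * L * sqrt (real n)" using n by simp
      finally have 2: "\<bar>mu n \<bullet> (hat (X n) j *\<^sub>v e)\<bar> \<le> K * (beta_norm * C) * L * sqrt (real n)" .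
      have "\<bar>mu n \<bullet> e\<bar> \<le> beta_norm * (L * sqrt (real n))"
        using goodD(2)[OF e] by (intro abs_mu_scalar_prod_le[OF ec])
      then have 3: "\<bar>mu n \<bullet> e\<bar> \<le> beta_norm * L * sqrt (real n)" by simp
      let ?r = "mu n - hat (X n) j *\<^sub>v mu n"
      have "c' \<le> (?r \<bullet> ?r) / real n"
        using elim(5) j unfolding mu_def[symmetric] Let_def by blast
      then have 4: "c' * real n \<le> ?r \<bullet> ?r" using n by (simp add: field_simps)
      show "c' * real n + e \<bullet> e - ?K * sqrt (real n) \<le> rss (X n) (mu n + e) j"
        using rss_add[OF X_carrier j(1) elim(2) mu_carrier ec] 1 2 3 4
        unfolding distrib_right abs_le_iff by argo
    qed
  qed
  moreover have "0 \<le> ?K" using K(1) L beta_norm_nonneg C_pos by simp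
  ultimately show ?thesis using that by blast
qed

lemma eventually_sqrt_le:
  assumes "0 < d"
  shows "\<forall>\<^sub>F n in sequentially. K * sqrt (real n) + K' \<le> d * real n"
proof -
  have "\<forall>\<^sub>F n in sequentially. K * sqrt (real n) + K' < d * real n" using assms by real_asymp
  then show ?thesis by eventually_elim simp
qed

text \<open>Keeps logarithms and quotients under control, for wrong models too, where the gain from
  (A3) absorbs the cross terms. The constant is half of the \<open>s / 2\<close> in
  \<open>good\<close>; for correct models the other half absorbs the bounded error.\<close>

lemma rss_lower:
  assumes j: "j \<subseteq> {..<p}" and L: "0 \<le> L"
  shows "\<forall>\<^sub>F n in sequentially. \<forall>e \<in> good L n. s / 4 * real n \<le> rss (X n) (mu n + e) j"
proof (cases "jstar \<subseteq> j")
  case True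
  obtain K where "0 \<le> K" and K: "\<forall>\<^sub>F n in sequentially. \<forall>e \<in> good L n. \<bar>rss (X n) (mu n + e) j - e \<bullet> e\<bar> \<le> K"
    by (rule rss_correct[OF j True])
  have "0 < s / 4" using s_pos by simp
  from K eventually_sqrt_le[OF this, of 0 K] show ?thesis
  proof eventually_elim
    case (elim n)
    show ?case
    proof
      fix e assume e: "e \<in> good L n"
      with elim(1) have "\<bar>rss (X n) (mu n + e) j - e \<bullet> e\<bar> \<le> K" by blast
      with goodD(3)[OF e] elim(2) show "s / 4 * real n \<le> rss (X n) (mu n + e) j" by simp
    qed
  qed
next
  case False
  obtain K where "0 \<le> K" and K: "\<forall>\<^sub>F n in sequentially. \<forall>e \<in> good L n.
      c' * real n + e \<bullet> e - K * sqrt (real n) \<le> rss (X n) (mu n + e) j"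
    by (rule rss_wrong[OF j False L])
  from K eventually_sqrt_le[OF c'_pos, of K 0] show ?thesis
  proof eventually_elim
    case (elim n)
    show ?case
    proof
      fix e assume e: "e \<in> good L n"
      with elim(1) have "c' * real n + e \<bullet> e - K * sqrt (real n) \<le> rss (X n) (mu n + e) j" by blast
      moreover have "s / 4 * real n \<le> s / 2 * real n" using s_pos by (intro mult_right_mono) auto
      ultimately show "s / 4 * real n \<le> rss (X n) (mu n + e) j"
        using goodD(3)[OF e] elim(2) by linarith
    qed
  qed
qed

lemma rss_upper:
  assumes j: "j \<subseteq> {..<p}" and L: "0 \<le> L"
  obtains K where "0 < K" "\<forall>\<^sub>F n in sequentially. \<forall>e \<in> good L n. rss (X n) (mu n + e) j \<le> K * real n"
proof -
  obtain K where K: "0 \<le> K" "\<forall>\<^sub>F n in sequentially. \<forall>u \<in> carrier_vec n. \<forall>v \<in> carrier_vec n. \<forall>b d.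
    (\<forall>i<p. \<bar>col (X n) i \<bullet> u\<bar> \<le> b) \<longrightarrow> (\<forall>i<p. \<bar>col (X n) i \<bullet> v\<bar> \<le> d) \<longrightarrow>
    \<bar>u \<bullet> (hat (X n) j *\<^sub>v v)\<bar> \<le> K * b * d / real n"
    by (rule hat_bilinear_bound[OF j(1)])
  let ?b = "beta_norm * C + L"
  \<comment> \<open>The first two summands come from bounding the squared norm of a sum by twice the
    sum of the squared norms, the last from the hat matrix applied to the full response.\<close>
  let ?K = "2 * (beta_norm\<^sup>2 * C) + 4 * s + K * ?b\<^sup>2"
  have "\<forall>\<^sub>F n in sequentially. \<forall>e \<in> good L n. rss (X n) (mu n + e) j \<le> ?K * real n"
    using K(2) gram_invertible[OF j] eventually_gt_at_top[of 0] mu_bounds response_bound[OF L]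
  proof eventually_elim
    case (elim n)
    show ?case
    proof
      fix e assume e: "e \<in> good L n"
      let ?y = "mu n + e"
      note ec = goodD(1)[OF e]
      have y: "?y \<in> carrier_vec n" and yb: "\<forall>a<p. \<bar>col (X n) a \<bullet> ?y\<bar> \<le> ?b * real n"
        using elim(5) e by auto
      have "\<bar>?y \<bullet> (hat (X n) j *\<^sub>v ?y)\<bar> \<le> K * (?b * real n) * (?b * real n) / real n"
        using elim(1) y yb by blast
      also have "\<dots> = K * ?b\<^sup>2 * real n" using elim(3) by (simp add: power2_eq_square)
      finally have 1: "\<bar>?y \<bullet> (hat (X n) j *\<^sub>v ?y)\<bar> \<le> K * ?b\<^sup>2 * real n" .
      have "?y \<bullet> ?y = mu n \<bullet> mu n + 2 * (mu n \<bullet> e) + e \<bullet> e"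
        using mu_carrier[of n] ec comm_scalar_prod[OF ec mu_carrier]
        by (simp add: scalar_prod_add_distrib[of _ n] add_scalar_prod_distrib[of _ n])
      moreover have "\<bar>mu n \<bullet> e\<bar> \<le> (mu n \<bullet> mu n + e \<bullet> e) / 2"
        using mu_carrier[of n] ec by (intro abs_scalar_prod_le) auto
      moreover have "mu n \<bullet> mu n \<le> beta_norm\<^sup>2 * C * real n" using elim(4) by auto
      ultimately have 2: "?y \<bullet> ?y \<le> 2 * (beta_norm\<^sup>2 * C * real n) + 2 * (2 * s * real n)"
        using goodD(4)[OF e] unfolding abs_le_iff by argo
      show "rss (X n) ?y j \<le> ?K * real n"
        unfolding rss_eq[OF X_carrier j elim(2) y] using 1 2 unfolding distrib_right abs_le_iff by argo
    qed
  qed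
  moreover have "0 < ?K" using K(1) s_pos C_pos by (intro add_nonneg_pos add_pos_nonneg mult_nonneg_nonneg) auto
  ultimately show ?thesis using that by blast
qed

section \<open>Comparison of logarithms of residual sums of squares\<close>

lemma log_rss_overfit:
  assumes j: "j \<subseteq> {..<p}" "jstar \<subseteq> j" and L: "0 \<le> L"
  obtains K where "\<forall>\<^sub>F n in sequentially. \<forall>e \<in> good L n.
    real n * ln (rss (X n) (mu n + e) jstar) - real n * ln (rss (X n) (mu n + e) j) \<le> K"
proof -
  obtain K where "0 \<le> K" and K: "\<forall>\<^sub>F n in sequentially. \<forall>e \<in> good L n. \<bar>rss (X n) (mu n + e) j - e \<bullet> e\<bar> \<le> K"
    by (rule rss_correct[OF j])
  obtain K' where "0 \<le> K'" and K': "\<forall>\<^sub>F n in sequentially. \<forall>e \<in> good L n. \<bar>rss (X n) (mu n + e) jstar - e \<bullet> e\<bar> \<le> K'"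
    by (rule rss_correct[OF jstar order_refl])
  have "\<forall>\<^sub>F n in sequentially. \<forall>e \<in> good L n.
    real n * ln (rss (X n) (mu n + e) jstar) - real n * ln (rss (X n) (mu n + e) j) \<le> (K + K') / (s / 4)"
    using K K' rss_lower[OF j(1) L] rss_lower[OF jstar L] eventually_gt_at_top[of 0]
  proof eventually_elim
    case (elim n)
    show ?case
    proof
      fix e assume e: "e \<in> good L n"
      let ?r = "rss (X n) (mu n + e) j" and ?q = "rss (X n) (mu n + e) jstar"
      have sn: "0 < s / 4 * real n" using s_pos elim(5) by simp
      have r: "s / 4 * real n \<le> ?r" and q: "s / 4 * real n \<le> ?q" using elim e by auto
      with sn have pos: "0 < ?r" "0 < ?q" by linarith+
      have d: "?q - ?r \<le> K + K'" using elim(1,2) e by (force dest: bspec)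
      have "ln ?q - ln ?r = ln (?q / ?r)" using pos by (simp add: ln_div)
      \<comment> \<open>The inequality \<open>ln x \<le> x - 1\<close> leaves a bounded difference
        over a denominator of order \<open>n\<close>, which cancels the factor
        \<open>real n\<close>.\<close>
      also have "\<dots> \<le> ?q / ?r - 1" using pos by (intro ln_le_minus_one) auto
      also have "\<dots> = (?q - ?r) / ?r" using pos by (simp add: field_simps)
      also have "\<dots> \<le> (K + K') / ?r" using d pos by (intro divide_right_mono) auto
      also have "\<dots> \<le> (K + K') / (s / 4 * real n)"
        using r sn pos \<open>0 \<le> K\<close> \<open>0 \<le> K'\<close> s_pos elim(5) by (intro divide_left_mono) auto
      finally have "real n * (ln ?q - ln ?r) \<le> real n * ((K + K') / (s / 4 * real n))"
        by (intro mult_left_mono) auto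
      then show "real n * ln ?q - real n * ln ?r \<le> (K + K') / (s / 4)"
        using elim(5) by (simp add: right_diff_distrib)
    qed
  qed
  with that show ?thesis by blast
qed

lemma log_rss_wrong:
  assumes j: "j \<subseteq> {..<p}" "\<not> jstar \<subseteq> j" and L: "0 \<le> L"
  obtains h where "0 < h" "\<forall>\<^sub>F n in sequentially. \<forall>e \<in> good L n.
    real n * ln (rss (X n) (mu n + e) jstar) + h * real n \<le> real n * ln (rss (X n) (mu n + e) j)"
proof -
  obtain K where "0 \<le> K" and K: "\<forall>\<^sub>F n in sequentially. \<forall>e \<in> good L n.
      c' * real n + e \<bullet> e - K * sqrt (real n) \<le> rss (X n) (mu n + e) j"
    by (rule rss_wrong[OF j L])
  obtain K' where "0 \<le> K'" and K': "\<forall>\<^sub>F n in sequentially. \<forall>e \<in> good L n. \<bar>rss (X n) (mu n + e) jstar - e \<bullet> e\<bar> \<le> K'"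
    by (rule rss_correct[OF jstar order_refl])
  obtain U where U0: "0 < U" and U: "\<forall>\<^sub>F n in sequentially. \<forall>e \<in> good L n. rss (X n) (mu n + e) jstar \<le> U * real n"
    by (rule rss_upper[OF jstar L])
  have c2: "0 < c' / 2" using c'_pos by simp
  have "\<forall>\<^sub>F n in sequentially. \<forall>e \<in> good L n.
    real n * ln (rss (X n) (mu n + e) jstar) + ln (1 + c' / 2 / U) * real n \<le> real n * ln (rss (X n) (mu n + e) j)"
    using K K' U rss_lower[OF jstar L] eventually_gt_at_top[of 0] eventually_sqrt_le[OF c2, of K K']
  proof eventually_elim
    case (elim n)
    show ?case
    proof
      fix e assume e: "e \<in> good L n"
      let ?r = "rss (X n) (mu n + e) j" and ?q = "rss (X n) (mu n + e) jstar"
      have sn: "0 < s / 4 * real n" using s_pos elim(5) by simp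
      have "s / 4 * real n \<le> ?q" using elim e by auto
      with sn have q: "0 < ?q" by linarith
      have "c' * real n + e \<bullet> e - K * sqrt (real n) \<le> ?r" "\<bar>?q - e \<bullet> e\<bar> \<le> K'" "?q \<le> U * real n"
        using elim(1,2,3) e by blast+
      then have r: "?q + c' / 2 * real n \<le> ?r" and qU: "?q \<le> U * real n" using elim(6) by (simp_all add: abs_le_iff)
      \<comment> \<open>The additive gain becomes a multiplicative one because \<open>?q\<close> is
        itself at most \<open>U * real n\<close>; \<open>h\<close> is the logarithm of this factor.
        The other half of \<open>c'\<close> has paid for the error terms.\<close>
      have "(1 + c' / 2 / U) * ?q = ?q + c' / 2 / U * ?q" by (simp add: distrib_right)
      also have "\<dots> \<le> ?q + c' / 2 / U * (U * real n)"
        using qU U0 c2 by (intro add_left_mono mult_left_mono) auto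
      also have "\<dots> = ?q + c' / 2 * real n" using U0 by simp
      finally have le: "(1 + c' / 2 / U) * ?q \<le> ?r" using r by linarith
      have p1: "0 < 1 + c' / 2 / U" using U0 c2 by (simp add: add_pos_pos)
      have "ln (1 + c' / 2 / U) + ln ?q = ln ((1 + c' / 2 / U) * ?q)"
        using ln_mult_pos[OF p1 q] by simp
      also have "\<dots> \<le> ln ?r" using le p1 q by (intro ln_mono) (auto intro: mult_pos_pos)
      finally have "real n * (ln (1 + c' / 2 / U) + ln ?q) \<le> real n * ln ?r" by (intro mult_left_mono) auto
      then show "real n * ln ?q + ln (1 + c' / 2 / U) * real n \<le> real n * ln ?r"
        by (simp add: algebra_simps)
    qed
  qed
  moreover have "0 < ln (1 + c' / 2 / U)" using U0 c2 by (intro ln_gt_zero) simp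
  ultimately show ?thesis using that by blast
qed

text \<open>The term \<open>k n\<close> must not depend on \<open>j\<close>: it cancels when two models are compared.\<close>

definition log_n_penalized :: "(nat \<Rightarrow> real vec \<Rightarrow> nat set \<Rightarrow> real) \<Rightarrow> bool" where
  "log_n_penalized crit \<longleftrightarrow> (\<exists>k :: nat \<Rightarrow> real. \<forall>j. j \<subseteq> {..<p} \<longrightarrow> (\<forall>L\<ge>0. \<exists>B.
     \<forall>\<^sub>F n in sequentially. \<forall>e \<in> good L n. \<bar>crit n (mu n + e) j
       - (real n * ln (rss (X n) (mu n + e) j) + real (card j) * ln (real n) + k n)\<bar> \<le> B))"

lemma log_n_penalized_selects:
  assumes crit: "log_n_penalized crit" and L: "0 \<le> L"
  shows "\<forall>\<^sub>F n in sequentially. \<forall>j. j \<subseteq> {..<p} \<and> j \<noteq> jstar \<longrightarrow>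
    (\<forall>e \<in> good L n. crit n (mu n + e) jstar < crit n (mu n + e) j)"
proof -
  obtain k :: "nat \<Rightarrow> real" where k: "\<And>j. j \<subseteq> {..<p} \<Longrightarrow> \<exists>B.
     \<forall>\<^sub>F n in sequentially. \<forall>e \<in> good L n. \<bar>crit n (mu n + e) j
       - (real n * ln (rss (X n) (mu n + e) j) + real (card j) * ln (real n) + k n)\<bar> \<le> B"
    using crit L unfolding log_n_penalized_def by blast
  obtain Bs where Bs: "\<forall>\<^sub>F n in sequentially. \<forall>e \<in> good L n. \<bar>crit n (mu n + e) jstar
       - (real n * ln (rss (X n) (mu n + e) jstar) + real (card jstar) * ln (real n) + k n)\<bar> \<le> Bs"
    using k[OF jstar] by blast
  have one: "\<forall>\<^sub>F n in sequentially. \<forall>e \<in> good L n. crit n (mu n + e) jstar < crit n (mu n + e) j"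
    if j: "j \<subseteq> {..<p}" "j \<noteq> jstar" for j
  proof -
    obtain B where B: "\<forall>\<^sub>F n in sequentially. \<forall>e \<in> good L n. \<bar>crit n (mu n + e) j
       - (real n * ln (rss (X n) (mu n + e) j) + real (card j) * ln (real n) + k n)\<bar> \<le> B"
      using k[OF j(1)] by blast
    show ?thesis
    proof (cases "jstar \<subseteq> j")
      case True
      obtain K where K: "\<forall>\<^sub>F n in sequentially. \<forall>e \<in> good L n.
          real n * ln (rss (X n) (mu n + e) jstar) - real n * ln (rss (X n) (mu n + e) j) \<le> K"
        by (rule log_rss_overfit[OF j(1) True L])
      have "card jstar < card j"
        using True j finite_subset[OF j(1)] by (intro psubset_card_mono) auto
      then have card: "1 + real (card jstar) \<le> real (card j)" by simp
      have "\<forall>\<^sub>F n in sequentially. K + B + Bs < ln (real n)" by real_asymp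
      with B Bs K eventually_ge_at_top[of 1] show ?thesis
      proof eventually_elim
        case (elim n)
        have "(1 + real (card jstar)) * ln (real n) \<le> real (card j) * ln (real n)"
          using card elim(4) by (intro mult_right_mono) auto
        then have pen: "real (card jstar) * ln (real n) + ln (real n) \<le> real (card j) * ln (real n)"
          by (simp add: distrib_right)
        show ?case
        proof
          fix e assume e: "e \<in> good L n"
          show "crit n (mu n + e) jstar < crit n (mu n + e) j"
            using bspec[OF elim(1) e] bspec[OF elim(2) e] bspec[OF elim(3) e] pen elim(5)
            unfolding abs_le_iff by linarith
        qed
      qed
    next
      case False
      obtain h where h: "0 < h" "\<forall>\<^sub>F n in sequentially. \<forall>e \<in> good L n.
          real n * ln (rss (X n) (mu n + e) jstar) + h * real n \<le> real n * ln (rss (X n) (mu n + e) j)"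
        by (rule log_rss_wrong[OF j(1) False L])
      have "\<forall>\<^sub>F n in sequentially. real (card jstar) * ln (real n) + B + Bs < h * real n"
        using h(1) by real_asymp
      with B Bs h(2) eventually_ge_at_top[of 1] show ?thesis
      proof eventually_elim
        case (elim n)
        have pen: "0 \<le> real (card j) * ln (real n)" using elim(4) by simp
        show ?case
        proof
          fix e assume e: "e \<in> good L n"
          show "crit n (mu n + e) jstar < crit n (mu n + e) j"
            using bspec[OF elim(1) e] bspec[OF elim(2) e] bspec[OF elim(3) e] pen elim(5)
            unfolding abs_le_iff by linarith
        qed
      qed
    qed
  qed
  \<comment> \<open>There are finitely many models, so their thresholds in \<open>n\<close>
    combine.\<close>
  have "\<forall>\<^sub>F n in sequentially. \<forall>j \<in> Pow {..<p} - {jstar}.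
     \<forall>e \<in> good L n. crit n (mu n + e) jstar < crit n (mu n + e) j"
    using one by (intro eventually_ball_finite) auto
  then show ?thesis by eventually_elim auto
qed

end

section \<open>Expansion of the five criteria\<close>

context regression_design
begin

text \<open>By homogeneity, undoing the scaling contributes
  \<open>real (card j) * ln (real n)\<close>, and the scaled determinant lies between positive
  constants. This is how a log determinant acts as the penalty that other criteria state
  explicitly.\<close>

lemma ln_det_gram_plus:
  assumes j: "j \<subseteq> {..<p}" and R: "R \<in> carrier_mat (card j) (card j)"
  obtains B where "\<forall>\<^sub>F n in sequentially. det (gram (X n) j + R) \<noteq> 0
    \<and> \<bar>ln (det (gram (X n) j + R)) - real (card j) * ln (real n)\<bar> \<le> B"
proof -
  have "\<forall>\<^sub>F n in sequentially. det (gram (X n) j + R) \<noteq> 0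
    \<and> \<bar>ln (det (gram (X n) j + R)) - real (card j) * ln (real n)\<bar> \<le> \<bar>ln (c / 2)\<bar> + \<bar>ln (C + c / 2)\<bar>"
    using det_scaled[OF j R] eventually_gt_at_top[of 0]
  proof eventually_elim
    case (elim n)
    define D where "D = det ((1 / real n) \<cdot>\<^sub>m (gram (X n) j + R))"
    have bounds: "c / 2 \<le> D" "D \<le> C + c / 2" using elim(1) unfolding D_def by auto
    then have D: "0 < D" using c_pos by linarith
    have "gram (X n) j + R = real n \<cdot>\<^sub>m ((1 / real n) \<cdot>\<^sub>m (gram (X n) j + R))"
      using R gram_X_carrier[OF j, of n] elim(2) by (auto intro!: eq_matI)
    then have "det (gram (X n) j + R) = det (real n \<cdot>\<^sub>m ((1 / real n) \<cdot>\<^sub>m (gram (X n) j + R)))" by (rule arg_cong)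
    also have "\<dots> = real n ^ card j * D"
      unfolding det_smult[of "real n"] D_def[symmetric] using R by simp
    finally have eq: "det (gram (X n) j + R) = real n ^ card j * D" .
    then have ln_eq: "ln (det (gram (X n) j + R)) = real (card j) * ln (real n) + ln D"
      using D elim(2) by (simp add: ln_mult_pos ln_realpow)
    have "ln (c / 2) \<le> ln D" "ln D \<le> ln (C + c / 2)"
      using bounds c_pos D by (auto intro!: ln_mono)
    then show ?case using eq ln_eq D elim(2) by auto
  qed
  with that show ?thesis by blast
qed

lemma ln_det_gram:
  assumes j: "j \<subseteq> {..<p}"
  obtains B where "\<forall>\<^sub>F n in sequentially. \<bar>ln (det (gram (X n) j)) - real (card j) * ln (real n)\<bar> \<le> B"
  using ln_det_gram_plus[OF j zero_carrier_mat] gram_X_carrier[OF j]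
  by (auto simp: eventually_conj_iff)

text \<open>Factoring out \<open>V\<close> leaves \<open>gram (X n) j + minv V\<close>, a fixed
  perturbation of the Gram matrix, and \<open>ln (det V)\<close> is a constant.\<close>

lemma ln_det_W_gram:
  assumes j: "j \<subseteq> {..<p}" and W: "pos_def_mat (card j) (V :: real mat)"
  obtains B where "\<forall>\<^sub>F n in sequentially.
    \<bar>ln (det (V * gram (X n) j + 1\<^sub>m (card j))) - real (card j) * ln (real n)\<bar> \<le> B"
proof -
  have Vc: "V \<in> carrier_mat (card j) (card j)" using W unfolding pos_def_mat_def by auto
  note d = pos_def_mat_det_nonzero[OF W]
  note V = minv_inverts[OF Vc d]
  obtain B where B: "\<forall>\<^sub>F n in sequentially. det (gram (X n) j + minv V) \<noteq> 0
    \<and> \<bar>ln (det (gram (X n) j + minv V)) - real (card j) * ln (real n)\<bar> \<le> B"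
    by (rule ln_det_gram_plus[OF j V(1)])
  have "\<forall>\<^sub>F n in sequentially.
    \<bar>ln (det (V * gram (X n) j + 1\<^sub>m (card j))) - real (card j) * ln (real n)\<bar> \<le> B + \<bar>ln (det V)\<bar>"
    using B
  proof eventually_elim
    case (elim n)
    have "V * gram (X n) j + 1\<^sub>m (card j) = V * (gram (X n) j + minv V)"
      using mult_add_distrib_mat[OF Vc gram_X_carrier[OF j] V(1)] V(2) by simp
    then have "ln (det (V * gram (X n) j + 1\<^sub>m (card j))) = ln (det V * det (gram (X n) j + minv V))"
      using det_mult[OF Vc, of "gram (X n) j + minv V"] V(1) by simp
    also have "\<dots> = ln (det V) + ln (det (gram (X n) j + minv V))"
      using d elim by (simp add: ln_mult)
    finally show ?case using elim unfolding abs_le_iff by linarith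
  qed
  with that show ?thesis by blast
qed

end

context regression_model
begin

lemma IC_pi2_penalized: "log_n_penalized (\<lambda>n. IC_pi2 W (X n))"
  unfolding log_n_penalized_def
\<comment> \<open>The common term converts \<open>sig_hat\<close> into \<open>rss\<close>: it
  collects the factor \<open>2 * pi / real n\<close> inside the logarithm.\<close>
proof (intro exI[of _ "\<lambda>n. real n * ln (2 * pi / real n)"] allI impI)
  fix j and L :: real assume j: "j \<subseteq> {..<p}" and L: "0 \<le> L"
  have "\<forall>\<^sub>F n in sequentially. \<forall>e \<in> good L n. \<bar>IC_pi2 W (X n) (mu n + e) j
      - (real n * ln (rss (X n) (mu n + e) j) + real (card j) * ln (real n) + real n * ln (2 * pi / real n))\<bar> \<le> real (card j)"
    using rss_lower[OF j L] eventually_gt_at_top[of 0]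
  proof eventually_elim
    case (elim n)
    show ?case
    proof
      fix e assume e: "e \<in> good L n"
      let ?r = "rss (X n) (mu n + e) j"
      have "0 < s / 4 * real n" using s_pos elim(2) by simp
      moreover have "s / 4 * real n \<le> ?r" using elim e by auto
      ultimately have r: "0 < ?r" by linarith
      have h: "ln (2 * pi * (?r / real n)) = ln (2 * pi / real n) + ln ?r"
        using r elim(2) ln_mult_pos[of "2 * pi / real n" ?r] by simp
      have dim: "dim_row (X n) = n" using X_carrier[of n] by auto
      show "\<bar>IC_pi2 W (X n) (mu n + e) j - (real n * ln ?r + real (card j) * ln (real n) + real n * ln (2 * pi / real n))\<bar> \<le> real (card j)"
        unfolding IC_pi2_def sig_hat_def Let_def dim h by (simp add: distrib_left)
    qed
  qed
  then show "\<exists>B. \<forall>\<^sub>F n in sequentially. \<forall>e \<in> good L n. \<bar>IC_pi2 W (X n) (mu n + e) j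
      - (real n * ln (rss (X n) (mu n + e) j) + real (card j) * ln (real n) + real n * ln (2 * pi / real n))\<bar> \<le> B" ..
qed

text \<open>With the residual projection in place of \<open>Amat\<close> the quotient would be
  exactly \<open>n\<close>; the bounded error is divided by \<open>sig_hat\<close>, which stays
  above \<open>s / 4\<close>.\<close>

lemma Amat_ratio:
  assumes j: "j \<subseteq> {..<p}" and W: "pos_def_mat (card j) (W j)" and L: "0 \<le> L"
  obtains B where "\<forall>\<^sub>F n in sequentially. \<forall>e \<in> good L n. let y = mu n + e in
     \<bar>(y \<bullet> (Amat W (X n) j *\<^sub>v y)) / sig_hat (X n) y j - real n\<bar> \<le> B"
proof -
  obtain K where "0 \<le> K" and K: "\<forall>\<^sub>F n in sequentially. \<forall>y \<in> carrier_vec n. \<forall>b.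
    (\<forall>i<p. \<bar>col (X n) i \<bullet> y\<bar> \<le> b) \<longrightarrow>
    \<bar>y \<bullet> (Amat W (X n) j *\<^sub>v y) - rss (X n) y j\<bar> \<le> K * b\<^sup>2 / (real n)\<^sup>2"
    by (rule Amat_bound[where W = W, OF j W])
  let ?b = "beta_norm * C + L"
  have "\<forall>\<^sub>F n in sequentially. \<forall>e \<in> good L n. let y = mu n + e in
     \<bar>(y \<bullet> (Amat W (X n) j *\<^sub>v y)) / sig_hat (X n) y j - real n\<bar> \<le> K * ?b\<^sup>2 / (s / 4)"
    using K response_bound[OF L] rss_lower[OF j L] eventually_gt_at_top[of 0]
  proof eventually_elim
    case (elim n)
    show ?case unfolding Let_def
    proof
      fix e assume e: "e \<in> good L n"
      let ?y = "mu n + e"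
      let ?r = "rss (X n) ?y j" and ?q = "?y \<bullet> (Amat W (X n) j *\<^sub>v ?y)"
      have sn: "0 < s / 4 * real n" using s_pos elim(4) by simp
      have r: "s / 4 * real n \<le> ?r" using elim e by auto
      with sn have pos: "0 < ?r" by linarith
      have "\<bar>?q - ?r\<bar> \<le> K * (?b * real n)\<^sup>2 / (real n)\<^sup>2" using elim(1,2) e by blast
      also have "\<dots> = K * ?b\<^sup>2" using elim(4) by (simp add: power_mult_distrib)
      finally have d: "\<bar>?q - ?r\<bar> \<le> K * ?b\<^sup>2" .
      have "?q / sig_hat (X n) ?y j - real n = (?q - ?r) * (real n / ?r)"
        using pos X_carrier[of n] elim(4) by (simp add: sig_hat_def field_simps)
      then have "\<bar>?q / sig_hat (X n) ?y j - real n\<bar> = \<bar>?q - ?r\<bar> * (real n / ?r)"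
        using pos by (simp add: abs_mult)
      also have "\<dots> \<le> K * ?b\<^sup>2 * (real n / (s / 4 * real n))"
        using d r sn pos \<open>0 \<le> K\<close> s_pos elim(4) by (intro mult_mono divide_left_mono) auto
      also have "\<dots> = K * ?b\<^sup>2 / (s / 4)" using elim(4) by simp
      finally show "\<bar>?q / sig_hat (X n) ?y j - real n\<bar> \<le> K * ?b\<^sup>2 / (s / 4)" .
    qed
  qed
  with that show ?thesis by blast
qed

text \<open>Lets each criterion be compared with a simpler one: \<open>IC_pi1_star\<close> and
  \<open>IC_r_star\<close> with \<open>IC_pi2\<close>, then \<open>IC_pi1\<close> and
  \<open>IC_r\<close> with their starred versions.\<close>

lemma log_n_penalized_add:
  assumes crit: "log_n_penalized crit"
    and rem: "\<And>j L. j \<subseteq> {..<p} \<Longrightarrow> 0 \<le> L \<Longrightarrow> \<exists>B. \<forall>\<^sub>F n in sequentially. \<forall>e \<in> good L n.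
      \<bar>crit' n (mu n + e) j - crit n (mu n + e) j - k' n\<bar> \<le> B"
  shows "log_n_penalized crit'"
proof -
  obtain k where k: "\<And>j L. j \<subseteq> {..<p} \<Longrightarrow> 0 \<le> L \<Longrightarrow> \<exists>B.
     \<forall>\<^sub>F n in sequentially. \<forall>e \<in> good L n. \<bar>crit n (mu n + e) j
       - (real n * ln (rss (X n) (mu n + e) j) + real (card j) * ln (real n) + k n)\<bar> \<le> B"
    using crit unfolding log_n_penalized_def by blast
  show ?thesis unfolding log_n_penalized_def
  proof (intro exI[of _ "\<lambda>n. k n + k' n"] allI impI)
    fix j and L :: real assume jL: "j \<subseteq> {..<p}" "0 \<le> L"
    obtain B1 where B1: "\<forall>\<^sub>F n in sequentially. \<forall>e \<in> good L n. \<bar>crit n (mu n + e) j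
       - (real n * ln (rss (X n) (mu n + e) j) + real (card j) * ln (real n) + k n)\<bar> \<le> B1"
      using k[OF jL] by blast
    obtain B2 where B2: "\<forall>\<^sub>F n in sequentially. \<forall>e \<in> good L n.
      \<bar>crit' n (mu n + e) j - crit n (mu n + e) j - k' n\<bar> \<le> B2"
      using rem[OF jL] by blast
    have "\<forall>\<^sub>F n in sequentially. \<forall>e \<in> good L n. \<bar>crit' n (mu n + e) j
       - (real n * ln (rss (X n) (mu n + e) j) + real (card j) * ln (real n) + (k n + k' n))\<bar> \<le> B1 + B2"
      using B1 B2
    proof eventually_elim
      case (elim n)
      show ?case
      proof
        fix e assume e: "e \<in> good L n"
        show "\<bar>crit' n (mu n + e) j - (real n * ln (rss (X n) (mu n + e) j)
            + real (card j) * ln (real n) + (k n + k' n))\<bar> \<le> B1 + B2"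
          using bspec[OF elim(1) e] bspec[OF elim(2) e] unfolding abs_le_iff by linarith
      qed
    qed
    then show "\<exists>B. \<forall>\<^sub>F n in sequentially. \<forall>e \<in> good L n. \<bar>crit' n (mu n + e) j
       - (real n * ln (rss (X n) (mu n + e) j) + real (card j) * ln (real n) + (k n + k' n))\<bar> \<le> B" ..
  qed
qed

lemma IC_pi1_star_penalized:
  assumes W: "\<And>j. j \<subseteq> {..<p} \<Longrightarrow> pos_def_mat (card j) (W j)"
  shows "log_n_penalized (\<lambda>n. IC_pi1_star W (X n))"
\<comment> \<open>The shift \<open>real n\<close> is the leading term of the quotient with
  \<open>Amat\<close>.\<close>
proof (rule log_n_penalized_add[OF IC_pi2_penalized[of W], where k' = "\<lambda>n. real n"])
  fix j and L :: real assume j: "j \<subseteq> {..<p}" and L: "0 \<le> L"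
  obtain B where B: "\<forall>\<^sub>F n in sequentially. \<forall>e \<in> good L n. let y = mu n + e in
     \<bar>(y \<bullet> (Amat W (X n) j *\<^sub>v y)) / sig_hat (X n) y j - real n\<bar> \<le> B"
    by (rule Amat_ratio[where W = W, OF j W[OF j] L])
  from B have "\<forall>\<^sub>F n in sequentially. \<forall>e \<in> good L n. \<bar>IC_pi1_star W (X n) (mu n + e) j
      - IC_pi2 W (X n) (mu n + e) j - real n\<bar> \<le> B + 2 + real (card j)"
  proof eventually_elim
    case (elim n)
    show ?case
    proof
      fix e assume e: "e \<in> good L n"
      show "\<bar>IC_pi1_star W (X n) (mu n + e) j - IC_pi2 W (X n) (mu n + e) j - real n\<bar> \<le> B + 2 + real (card j)"
        using bspec[OF elim e] unfolding IC_pi1_star_def IC_pi2_def Let_def abs_le_iff by linarith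
    qed
  qed
  then show "\<exists>B. \<forall>\<^sub>F n in sequentially. \<forall>e \<in> good L n.
      \<bar>IC_pi1_star W (X n) (mu n + e) j - IC_pi2 W (X n) (mu n + e) j - real n\<bar> \<le> B" ..
qed

lemma IC_pi1_penalized:
  assumes W: "\<And>j. j \<subseteq> {..<p} \<Longrightarrow> pos_def_mat (card j) (W j)"
  shows "log_n_penalized (\<lambda>n. IC_pi1 W (X n))"
proof (rule log_n_penalized_add[OF IC_pi1_star_penalized[OF W], where k' = "\<lambda>n. 0"])
  fix j and L :: real assume j: "j \<subseteq> {..<p}"
  obtain B where B: "\<forall>\<^sub>F n in sequentially.
    \<bar>ln (det (W j * gram (X n) j + 1\<^sub>m (card j))) - real (card j) * ln (real n)\<bar> \<le> B"
    by (rule ln_det_W_gram[OF j W[OF j]])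
  have "\<forall>\<^sub>F n in sequentially. \<bar>2 * real n / (real n - real (card j) - 2)\<bar> < 3" by real_asymp
  \<comment> \<open>In \<open>B + 5\<close>, the 3 bounds the rational term, whose limit is 2, and
    the 2 is the constant in \<open>IC_pi1_star\<close>.\<close>
  with B have "\<forall>\<^sub>F n in sequentially. \<forall>e \<in> good L n. \<bar>IC_pi1 W (X n) (mu n + e) j
      - IC_pi1_star W (X n) (mu n + e) j - 0\<bar> \<le> B + 5"
  proof eventually_elim
    case (elim n)
    have dim: "dim_row (X n) = n" using X_carrier[of n] by auto
    show ?case using elim
      unfolding IC_pi1_def IC_pi1_star_def Let_def dim abs_le_iff abs_less_iff by (intro ballI) linarith
  qed
  then show "\<exists>B. \<forall>\<^sub>F n in sequentially. \<forall>e \<in> good L n.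
      \<bar>IC_pi1 W (X n) (mu n + e) j - IC_pi1_star W (X n) (mu n + e) j - 0\<bar> \<le> B" ..
qed auto

text \<open>With \<open>k = card j\<close>, passing from \<open>n\<close> to \<open>n - k\<close> in
  the factor and in the variance estimate costs \<open>(n - k) ln (n / (n - k))\<close>, which tends
  to \<open>k\<close>, and \<open>k\<close> times a logarithm that is bounded because
  \<open>rss / n\<close> stays between positive constants.\<close>

lemma log_sig_tilde:
  assumes j: "j \<subseteq> {..<p}" and L: "0 \<le> L"
  obtains B where "\<forall>\<^sub>F n in sequentially. \<forall>e \<in> good L n. let y = mu n + e in
    \<bar>(real n - real (card j)) * ln (2 * pi * sig_tilde (X n) y j) - real n * ln (2 * pi * sig_hat (X n) y j)\<bar> \<le> B"
proof -
  let ?k = "real (card j)"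
  obtain U where "0 < U" and U: "\<forall>\<^sub>F n in sequentially. \<forall>e \<in> good L n. rss (X n) (mu n + e) j \<le> U * real n"
    by (rule rss_upper[OF j L])
  have 1: "\<forall>\<^sub>F n in sequentially. \<bar>(real n - ?k) * (ln (real n) - ln (real n - ?k))\<bar> < ?k + 1"
  proof -
    have "(\<lambda>n. (real n - ?k) * (ln (real n) - ln (real n - ?k))) \<longlonglongrightarrow> ?k" by real_asymp
    then have "(\<lambda>n. \<bar>(real n - ?k) * (ln (real n) - ln (real n - ?k))\<bar>) \<longlonglongrightarrow> \<bar>?k\<bar>" by (rule tendsto_rabs)
    moreover have "\<bar>?k\<bar> < ?k + 1" by simp
    ultimately show ?thesis by (rule order_tendstoD(2))
  qed
  have "\<forall>\<^sub>F n in sequentially. \<forall>e \<in> good L n. let y = mu n + e in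
    \<bar>(real n - real (card j)) * ln (2 * pi * sig_tilde (X n) y j) - real n * ln (2 * pi * sig_hat (X n) y j)\<bar>
    \<le> ?k * (\<bar>ln (2 * pi)\<bar> + (\<bar>ln (s / 4)\<bar> + \<bar>ln U\<bar>)) + (?k + 1)"
    using U rss_lower[OF j L] 1 eventually_gt_at_top[of "card j"]
  proof eventually_elim
    case (elim n)
    have dim: "dim_row (X n) = n" using X_carrier[of n] by auto
    have n: "0 < real n" "0 < real n - ?k" using elim(4) by auto
    show ?case unfolding Let_def
    proof
      fix e assume e: "e \<in> good L n"
      let ?r = "rss (X n) (mu n + e) j"
      have r: "s / 4 * real n \<le> ?r" "?r \<le> U * real n" using elim e by auto
      moreover have "0 < s / 4 * real n" using s_pos n by simp
      ultimately have pos: "0 < ?r" by linarith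
      have rn: "s / 4 \<le> ?r / real n" "?r / real n \<le> U" using r n by (simp_all add: field_simps)
      have "ln (s / 4) \<le> ln (?r / real n)" "ln (?r / real n) \<le> ln U"
        using rn s_pos pos n by (auto intro!: ln_mono)
      then have "\<bar>ln (?r / real n)\<bar> \<le> \<bar>ln (s / 4)\<bar> + \<bar>ln U\<bar>" by linarith
      then have "\<bar>ln (2 * pi) + ln (?r / real n)\<bar> \<le> \<bar>ln (2 * pi)\<bar> + (\<bar>ln (s / 4)\<bar> + \<bar>ln U\<bar>)" by linarith
      then have 2: "\<bar>?k * (ln (2 * pi) + ln (?r / real n))\<bar> \<le> ?k * (\<bar>ln (2 * pi)\<bar> + (\<bar>ln (s / 4)\<bar> + \<bar>ln U\<bar>))"
        unfolding abs_mult by (intro mult_mono) auto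
      have t: "ln (2 * pi * sig_tilde (X n) (mu n + e) j) = ln (2 * pi) + ln ?r - ln (real n - ?k)"
        unfolding sig_tilde_def dim using pos n ln_mult_pos[of "2 * pi" "?r / (real n - ?k)"] by (simp add: ln_div)
      have h: "ln (2 * pi * sig_hat (X n) (mu n + e) j) = ln (2 * pi) + ln ?r - ln (real n)"
        unfolding sig_hat_def dim using pos n ln_mult_pos[of "2 * pi" "?r / real n"] by (simp add: ln_div)
      have lr: "ln (?r / real n) = ln ?r - ln (real n)" using pos n by (simp add: ln_div)
      have "(real n - ?k) * ln (2 * pi * sig_tilde (X n) (mu n + e) j) - real n * ln (2 * pi * sig_hat (X n) (mu n + e) j)
        = (real n - ?k) * (ln (real n) - ln (real n - ?k)) - ?k * (ln (2 * pi) + ln (?r / real n))"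
        unfolding t h lr by (simp add: algebra_simps)
      then show "\<bar>(real n - ?k) * ln (2 * pi * sig_tilde (X n) (mu n + e) j) - real n * ln (2 * pi * sig_hat (X n) (mu n + e) j)\<bar>
        \<le> ?k * (\<bar>ln (2 * pi)\<bar> + (\<bar>ln (s / 4)\<bar> + \<bar>ln U\<bar>)) + (?k + 1)"
        using 2 elim(3) by linarith
    qed
  qed
  with that show ?thesis by blast
qed

lemma IC_r_star_penalized: "log_n_penalized (\<lambda>n. IC_r_star W (X n))"
proof (rule log_n_penalized_add[OF IC_pi2_penalized[of W], where k' = "\<lambda>n. real n"])
  fix j and L :: real assume j: "j \<subseteq> {..<p}" and L: "0 \<le> L"
  let ?k = "real (card j)"
  obtain B where B: "\<forall>\<^sub>F n in sequentially. \<forall>e \<in> good L n. let y = mu n + e in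
    \<bar>(real n - ?k) * ln (2 * pi * sig_tilde (X n) y j) - real n * ln (2 * pi * sig_hat (X n) y j)\<bar> \<le> B"
    by (rule log_sig_tilde[OF j L])
  have "\<forall>\<^sub>F n in sequentially. \<bar>(real n - ?k)\<^sup>2 / (real n - ?k - 2) - real n\<bar> < ?k + 3"
  proof -
    \<comment> \<open>With \<open>m = n - k\<close> the quotient equals
      \<open>m + 2 + 4 / (m - 2)\<close>, hence the limit \<open>2 - k\<close> once the shift
      \<open>n\<close> is subtracted.\<close>
    have "(\<lambda>n. (real n - ?k)\<^sup>2 / (real n - ?k - 2) - real n) \<longlonglongrightarrow> 2 - ?k" by real_asymp
    then have "(\<lambda>n. \<bar>(real n - ?k)\<^sup>2 / (real n - ?k - 2) - real n\<bar>) \<longlonglongrightarrow> \<bar>2 - ?k\<bar>" by (rule tendsto_rabs)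
    moreover have "\<bar>2 - ?k\<bar> < ?k + 3" by simp
    ultimately show ?thesis by (rule order_tendstoD(2))
  qed
  with B have "\<forall>\<^sub>F n in sequentially. \<forall>e \<in> good L n. \<bar>IC_r_star W (X n) (mu n + e) j
      - IC_pi2 W (X n) (mu n + e) j - real n\<bar> \<le> B + (?k + 3) + ?k"
  proof eventually_elim
    case (elim n)
    have dim: "dim_row (X n) = n" using X_carrier[of n] by auto
    show ?case
    proof
      fix e assume e: "e \<in> good L n"
      show "\<bar>IC_r_star W (X n) (mu n + e) j - IC_pi2 W (X n) (mu n + e) j - real n\<bar> \<le> B + (?k + 3) + ?k"
        using bspec[OF elim(1) e] elim(2) unfolding IC_r_star_def IC_pi2_def Let_def dim abs_le_iff abs_less_iff by linarith
    qed
  qed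
  then show "\<exists>B. \<forall>\<^sub>F n in sequentially. \<forall>e \<in> good L n.
      \<bar>IC_r_star W (X n) (mu n + e) j - IC_pi2 W (X n) (mu n + e) j - real n\<bar> \<le> B" ..
qed

lemma IC_r_penalized: "log_n_penalized (\<lambda>n. IC_r W (X n))"
proof (rule log_n_penalized_add[OF IC_r_star_penalized[of W], where k' = "\<lambda>n. 0"])
  fix j and L :: real assume j: "j \<subseteq> {..<p}"
  let ?k = "real (card j)"
  obtain B where B: "\<forall>\<^sub>F n in sequentially. \<bar>ln (det (gram (X n) j)) - ?k * ln (real n)\<bar> \<le> B"
    by (rule ln_det_gram[OF j])
  from B eventually_gt_at_top[of "card j + 2"]
  have "\<forall>\<^sub>F n in sequentially. \<forall>e \<in> good L n. \<bar>IC_r W (X n) (mu n + e) j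
      - IC_r_star W (X n) (mu n + e) j - 0\<bar> \<le> B"
  proof eventually_elim
    case (elim n)
    have dim: "dim_row (X n) = n" using X_carrier[of n] by auto
    \<comment> \<open>This identity makes the rational parts of both criteria equal, so they differ
      only in the log determinant and its approximation \<open>?k * ln (real n)\<close>.\<close>
    have "m + 2 * m / (m - 2) = m\<^sup>2 / (m - 2)" if "m \<noteq> 2" for m :: real
      using that by (simp add: field_simps power2_eq_square)
    from this[of "real n - ?k"]
    have "(real n - ?k) + 2 * (real n - ?k) / (real n - ?k - 2) = (real n - ?k)\<^sup>2 / (real n - ?k - 2)"
      using elim(2) by simp
    then show ?case
      using elim(1) unfolding IC_r_def IC_r_star_def Let_def dim abs_le_iff by (intro ballI) linarith
  qed
  then show "\<exists>B. \<forall>\<^sub>F n in sequentially. \<forall>e \<in> good L n.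
      \<bar>IC_r W (X n) (mu n + e) j - IC_r_star W (X n) (mu n + e) j - 0\<bar> \<le> B" ..
qed

end

section \<open>Probability estimates and consistency\<close>

context prob_space
begin

text \<open>After expanding the square, independence and zero means remove all products with
  distinct indices.\<close>

lemma second_moment_indep_sum:
  fixes Z :: "'i \<Rightarrow> 'a \<Rightarrow> real"
  assumes ind: "indep_vars (\<lambda>_. borel) Z UNIV" and I: "finite I"
    and sq: "\<And>i. integrable M (\<lambda>\<omega>. (Z i \<omega>)\<^sup>2)"
    and mean: "\<And>i. expectation (Z i) = 0" and var: "\<And>i. expectation (\<lambda>\<omega>. (Z i \<omega>)\<^sup>2) = v"
  shows "integrable M (\<lambda>\<omega>. (\<Sum>i\<in>I. c i * Z i \<omega>)\<^sup>2)"
    and "expectation (\<lambda>\<omega>. (\<Sum>i\<in>I. c i * Z i \<omega>)\<^sup>2) = v * (\<Sum>i\<in>I. (c i)\<^sup>2)"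
proof -
  have meas: "Z i \<in> borel_measurable M" for i using ind unfolding indep_vars_def2 by auto
  have int: "integrable M (Z i)" for i
    using square_integrable_imp_integrable[OF meas sq] .
  have prod: "integrable M (\<lambda>\<omega>. Z i \<omega> * Z k \<omega>) \<and> expectation (\<lambda>\<omega>. Z i \<omega> * Z k \<omega>) = (if i = k then v else 0)" for i k
  proof (cases "i = k")
    case True
    then show ?thesis using sq[of k] var[of k] by (simp add: power2_eq_square)
  next
    case False
    have ik: "indep_vars (\<lambda>_. borel) Z {i, k}" using indep_vars_subset[OF ind] by simp
    show ?thesis
      using indep_vars_integrable[OF _ ik] indep_vars_lebesgue_integral[OF _ ik] int mean False by simp
  qed
  have eq: "(\<lambda>\<omega>. (\<Sum>i\<in>I. c i * Z i \<omega>)\<^sup>2) = (\<lambda>\<omega>. \<Sum>i\<in>I. \<Sum>k\<in>I. c i * c k * (Z i \<omega> * Z k \<omega>))"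
    by (simp add: power2_eq_square sum_product mult_ac)
  show "integrable M (\<lambda>\<omega>. (\<Sum>i\<in>I. c i * Z i \<omega>)\<^sup>2)"
    unfolding eq using prod by (intro Bochner_Integration.integrable_sum integrable_mult_right) auto
  have "expectation (\<lambda>\<omega>. (\<Sum>i\<in>I. c i * Z i \<omega>)\<^sup>2) = (\<Sum>i\<in>I. \<Sum>k\<in>I. c i * c k * expectation (\<lambda>\<omega>. Z i \<omega> * Z k \<omega>))"
    unfolding eq using prod
    by (subst Bochner_Integration.integral_sum, auto)+
  also have "\<dots> = (\<Sum>i\<in>I. \<Sum>k\<in>I. if i = k then c i * c i * v else 0)"
    using prod by (intro sum.cong) auto
  also have "\<dots> = v * (\<Sum>i\<in>I. (c i)\<^sup>2)"
    using I by (simp add: sum_distrib_left power2_eq_square mult_ac)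
  finally show "expectation (\<lambda>\<omega>. (\<Sum>i\<in>I. c i * Z i \<omega>)\<^sup>2) = v * (\<Sum>i\<in>I. (c i)\<^sup>2)" .
qed

lemma Chebyshev_indep_sum:
  fixes Z :: "'i \<Rightarrow> 'a \<Rightarrow> real"
  assumes ind: "indep_vars (\<lambda>_. borel) Z UNIV" and I: "finite I"
    and sq: "\<And>i. integrable M (\<lambda>\<omega>. (Z i \<omega>)\<^sup>2)"
    and mean: "\<And>i. expectation (Z i) = 0" and var: "\<And>i. expectation (\<lambda>\<omega>. (Z i \<omega>)\<^sup>2) = v"
    and t: "0 < t"
  shows "prob {\<omega> \<in> space M. t \<le> \<bar>\<Sum>i\<in>I. c i * Z i \<omega>\<bar>} \<le> v * (\<Sum>i\<in>I. (c i)\<^sup>2) / t\<^sup>2"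
proof -
  have meas: "Z i \<in> borel_measurable M" for i using ind unfolding indep_vars_def2 by auto
  have int: "integrable M (Z i)" for i
    using square_integrable_imp_integrable[OF meas sq] .
  have e: "expectation (\<lambda>\<omega>. \<Sum>i\<in>I. c i * Z i \<omega>) = 0"
    using int mean by (subst Bochner_Integration.integral_sum) auto
  have m: "(\<lambda>\<omega>. \<Sum>i\<in>I. c i * Z i \<omega>) \<in> borel_measurable M" using meas by measurable
  note sm = second_moment_indep_sum[OF ind I sq mean var, of c]
  from Chebyshev_inequality[OF m sm(1) t] show ?thesis using sm(2) e by simp
qed

end

section \<open>Measurability of the criteria\<close>

lemma borel_measurable_quadratic_form:
  fixes A :: "real mat"
  assumes A: "A \<in> carrier_mat n n" and y: "\<And>\<omega>. y \<omega> \<in> carrier_vec n"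
    and m: "\<And>i. i < n \<Longrightarrow> (\<lambda>\<omega>. y \<omega> $ i) \<in> borel_measurable M"
  shows "(\<lambda>\<omega>. y \<omega> \<bullet> (A *\<^sub>v y \<omega>)) \<in> borel_measurable M"
proof -
  have d: "dim_vec (y \<omega>) = n" for \<omega> using y by auto
  have "(\<lambda>\<omega>. y \<omega> \<bullet> (A *\<^sub>v y \<omega>)) = (\<lambda>\<omega>. \<Sum>i = 0..<n. y \<omega> $ i * (\<Sum>k = 0..<n. A $$ (i, k) * y \<omega> $ k))"
    using A by (auto simp: scalar_prod_def d fun_eq_iff intro!: sum.cong)
  also have "\<dots> \<in> borel_measurable M" using m by (intro borel_measurable_sum borel_measurable_times) auto
  finally show ?thesis .
qed

lemma borel_measurable_IC:
  assumes A: "A \<in> carrier_mat n p" and j: "j \<subseteq> {..<p}" and y: "\<And>\<omega>. y \<omega> \<in> carrier_vec n"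
    and m: "\<And>i. i < n \<Longrightarrow> (\<lambda>\<omega>. y \<omega> $ i) \<in> borel_measurable M"
    and IC: "IC \<in> {IC_pi1, IC_pi1_star, IC_pi2, IC_r, IC_r_star}"
  shows "(\<lambda>\<omega>. IC W A (y \<omega>) j) \<in> borel_measurable M"
proof -
  note d = carrier_matD(1)[OF Xsub_carrier[OF A j]] carrier_matD(1)[OF A]
  \<comment> \<open>The dimensions come from the outer factors of the products, so this also holds
    where \<open>gram A j\<close> is singular and \<open>minv\<close> is an unspecified
    matrix.\<close>
  have carrier: "1\<^sub>m (dim_row A) - hat A j \<in> carrier_mat n n" "Amat W A j \<in> carrier_mat n n"
    unfolding hat_def Amat_def by (rule carrier_matI; simp add: d)+
  have rss: "(\<lambda>\<omega>. rss A (y \<omega>) j) \<in> borel_measurable M"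
    unfolding rss_def by (rule borel_measurable_quadratic_form[OF carrier(1) y m])
  have Am: "(\<lambda>\<omega>. y \<omega> \<bullet> (Amat W A j *\<^sub>v y \<omega>)) \<in> borel_measurable M"
    by (rule borel_measurable_quadratic_form[OF carrier(2) y m])
  note [measurable] = rss Am
  have [measurable]: "(\<lambda>\<omega>. sig_hat A (y \<omega>) j) \<in> borel_measurable M"
    "(\<lambda>\<omega>. sig_tilde A (y \<omega>) j) \<in> borel_measurable M"
    unfolding sig_hat_def sig_tilde_def by measurable
  have "(\<lambda>\<omega>. IC_pi1 W A (y \<omega>) j) \<in> borel_measurable M"
    unfolding IC_pi1_def Let_def by measurable
  moreover have "(\<lambda>\<omega>. IC_pi1_star W A (y \<omega>) j) \<in> borel_measurable M"
    unfolding IC_pi1_star_def Let_def by measurable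
  moreover have "(\<lambda>\<omega>. IC_pi2 W A (y \<omega>) j) \<in> borel_measurable M"
    unfolding IC_pi2_def Let_def by measurable
  moreover have "(\<lambda>\<omega>. IC_r W A (y \<omega>) j) \<in> borel_measurable M"
    unfolding IC_r_def Let_def by measurable
  moreover have "(\<lambda>\<omega>. IC_r_star W A (y \<omega>) j) \<in> borel_measurable M"
    unfolding IC_r_star_def Let_def by measurable
  ultimately show ?thesis using IC by auto
qed

text \<open>\<open>q\<close> is the common variance of the squared errors. Identical distribution is
  recorded through the moments that enter Chebyshev's inequality.\<close>

locale random_regression = regression_model + prob_space M for M :: "'a measure" +
  fixes eps :: "nat \<Rightarrow> 'a \<Rightarrow> real" and q :: real
  assumes eps_indep: "indep_vars (\<lambda>_. borel) eps UNIV"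
    and eps_mean: "\<And>i. expectation (eps i) = 0"
    and eps_square: "\<And>i. integrable M (\<lambda>\<omega>. (eps i \<omega>)\<^sup>2)" "\<And>i. expectation (\<lambda>\<omega>. (eps i \<omega>)\<^sup>2) = s"
    and eps_fourth: "\<And>i. integrable M (\<lambda>\<omega>. ((eps i \<omega>)\<^sup>2 - s)\<^sup>2)"
      "\<And>i. expectation (\<lambda>\<omega>. ((eps i \<omega>)\<^sup>2 - s)\<^sup>2) = q"
begin

abbreviation (input) "noise n \<omega> \<equiv> vec n (\<lambda>i. eps i \<omega>)"

lemma eps_measurable [measurable]: "eps i \<in> borel_measurable M"
  using eps_indep unfolding indep_vars_def2 by auto

lemma prob_col_noise:
  assumes "0 < t"
  shows "prob {\<omega> \<in> space M. t \<le> \<bar>col (X n) a \<bullet> noise n \<omega>\<bar>} \<le> s * (col (X n) a \<bullet> col (X n) a) / t\<^sup>2"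
proof -
  have "dim_row (X n) = n" using X_carrier[of n] by auto
  then show ?thesis
    using Chebyshev_indep_sum[OF eps_indep _ eps_square(1) eps_mean eps_square(2) assms,
        of "{0..<n}" "\<lambda>i. col (X n) a $ i"]
    by (simp add: scalar_prod_def power2_eq_square)
qed

text \<open>The centred squares of the errors are again independent with mean zero, so the same
  inequality applies, now with \<open>q\<close> as the variance.\<close>

lemma prob_noise_square:
  assumes "0 < t"
  shows "prob {\<omega> \<in> space M. t \<le> \<bar>noise n \<omega> \<bullet> noise n \<omega> - s * real n\<bar>} \<le> q * real n / t\<^sup>2"
proof -
  have ind: "indep_vars (\<lambda>_. borel) (\<lambda>i \<omega>. (eps i \<omega>)\<^sup>2 - s) UNIV"
    by (rule indep_vars_compose2[OF eps_indep, where Y = "\<lambda>_ x. x\<^sup>2 - s"]) measurable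
  have mean: "expectation (\<lambda>\<omega>. (eps i \<omega>)\<^sup>2 - s) = 0" for i
    using eps_square[of i] by (simp add: prob_space)
  have "noise n \<omega> \<bullet> noise n \<omega> - s * real n = (\<Sum>i = 0..<n. 1 * ((eps i \<omega>)\<^sup>2 - s))" for \<omega>
    by (simp add: scalar_prod_def sum_subtractf power2_eq_square)
  then show ?thesis
    using Chebyshev_indep_sum[OF ind _ eps_fourth(1) mean eps_fourth(2) assms, of "{0..<n}" "\<lambda>_. 1"]
    by simp
qed

lemma prob_good:
  assumes d: "0 < d"
  shows "\<exists>L\<ge>0. \<forall>\<^sub>F n in sequentially.
    1 - d < prob {\<omega> \<in> space M. noise n \<omega> \<in> good L n} \<and> {\<omega> \<in> space M. noise n \<omega> \<in> good L n} \<in> sets M"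
proof -
  \<comment> \<open>A union bound over the \<open>p\<close> columns costs
    \<open>p * s * C / L^2\<close>, which this choice keeps below \<open>d / 2\<close>. The added 1
    makes the inequality strict and \<open>L\<close> positive.\<close>
  define L where "L = sqrt (2 * real p * s * C / d) + 1"
  have L: "0 < L" unfolding L_def using s_pos C_pos d by (intro add_nonneg_pos) auto
  have "2 * real p * s * C / d < L\<^sup>2"
  proof -
    have "0 \<le> 2 * real p * s * C / d" using s_pos C_pos d by auto
    then have "(sqrt (2 * real p * s * C / d))\<^sup>2 = 2 * real p * s * C / d"
      "0 \<le> sqrt (2 * real p * s * C / d)" by auto
    then show ?thesis unfolding L_def power2_sum by (simp add: add_pos_nonneg)
  qed
  then have "2 * real p * s * C < L\<^sup>2 * d" using d by (simp add: pos_divide_less_eq)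
  then have "real p * s * C < d / 2 * L\<^sup>2" by (simp add: mult.commute)
  then have Ld: "real p * (s * C / L\<^sup>2) < d / 2"
    using L pos_divide_less_eq[of "L\<^sup>2" "real p * s * C" "d / 2"] by (simp add: mult.assoc)
  \<comment> \<open>The other half of \<open>d\<close> pays for \<open>e \<bullet> e\<close>, whose
    exceptional probability tends to 0 whatever \<open>L\<close> is.\<close>
  have "(\<lambda>n. q / (s / 2)\<^sup>2 / real n) \<longlonglongrightarrow> 0" by (rule lim_const_over_n)
  then have "\<forall>\<^sub>F n in sequentially. q / (s / 2)\<^sup>2 / real n < d / 2" using d by (intro order_tendstoD(2)) auto
  with col_col_le eventually_gt_at_top[of 0]
  have "\<forall>\<^sub>F n in sequentially.
    1 - d < prob {\<omega> \<in> space M. noise n \<omega> \<in> good L n} \<and> {\<omega> \<in> space M. noise n \<omega> \<in> good L n} \<in> sets M"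
  proof eventually_elim
    case (elim n)
    have n: "0 < real n" using elim(2) by simp
    let ?G = "{\<omega> \<in> space M. noise n \<omega> \<in> good L n}"
    let ?Ba = "\<lambda>a. {\<omega> \<in> space M. L * sqrt (real n) \<le> \<bar>col (X n) a \<bullet> noise n \<omega>\<bar>}"
    let ?Bs = "{\<omega> \<in> space M. s / 2 * real n \<le> \<bar>noise n \<omega> \<bullet> noise n \<omega> - s * real n\<bar>}"
    have m1: "(\<lambda>\<omega>. col (X n) a \<bullet> noise n \<omega>) \<in> borel_measurable M" for a
      unfolding scalar_prod_def by simp
    have m2: "(\<lambda>\<omega>. noise n \<omega> \<bullet> noise n \<omega>) \<in> borel_measurable M"
      unfolding scalar_prod_def by simp
    note [measurable] = m1 m2
    have Ba: "?Ba a \<in> sets M" for a by measurable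
    have Bs: "?Bs \<in> sets M" by measurable
    have G: "?G \<in> sets M" unfolding good_def by simp measurable
    have "1 - prob ?G = prob (space M - ?G)" using prob_compl[OF G] by simp
    also have "\<dots> \<le> prob ((\<Union>a<p. ?Ba a) \<union> ?Bs)"
    proof (rule finite_measure_mono)
      show "space M - ?G \<subseteq> (\<Union>a<p. ?Ba a) \<union> ?Bs"
      proof
        fix \<omega> assume w: "\<omega> \<in> space M - ?G"
        show "\<omega> \<in> (\<Union>a<p. ?Ba a) \<union> ?Bs"
        proof (rule ccontr)
          assume neg: "\<omega> \<notin> (\<Union>a<p. ?Ba a) \<union> ?Bs"
          have "\<forall>a<p. \<bar>col (X n) a \<bullet> noise n \<omega>\<bar> \<le> L * sqrt (real n)" using neg w by force
          \<comment> \<open>Such a deviation leaves the squared norm between \<open>s / 2\<close>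
            and \<open>3 * s / 2\<close> times \<open>n\<close>, inside the range in
            \<open>good\<close>.\<close>
          moreover have "\<bar>noise n \<omega> \<bullet> noise n \<omega> - s * real n\<bar> < s / 2 * real n" using neg w by force
          then have "s / 2 * real n \<le> noise n \<omega> \<bullet> noise n \<omega>" "noise n \<omega> \<bullet> noise n \<omega> \<le> 2 * s * real n"
            using mult_pos_pos[OF s_pos n] unfolding abs_less_iff by argo+
          ultimately have "noise n \<omega> \<in> good L n" unfolding good_def by simp
          then show False using w by simp
        qed
      qed
    qed (use Ba Bs in auto)
    also have "\<dots> \<le> prob (\<Union>a<p. ?Ba a) + prob ?Bs"
      using Ba Bs by (intro measure_subadditive) auto
    also have "prob (\<Union>a<p. ?Ba a) \<le> (\<Sum>a<p. prob (?Ba a))"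
      using Ba by (intro finite_measure_subadditive_finite) auto
    also have "(\<Sum>a<p. prob (?Ba a)) \<le> (\<Sum>a<p. s * C / L\<^sup>2)"
    proof (rule sum_mono)
      fix a assume "a \<in> {..<p}"
      then have "\<bar>col (X n) a \<bullet> col (X n) a\<bar> \<le> C * real n" using elim(1) by auto
      then have "col (X n) a \<bullet> col (X n) a \<le> C * real n" by linarith
      have "0 < L * sqrt (real n)" using L n by simp
      note prob_col_noise[OF this, of n a]
      also have "s * (col (X n) a \<bullet> col (X n) a) / (L * sqrt (real n))\<^sup>2 \<le> s * (C * real n) / (L * sqrt (real n))\<^sup>2"
        using s_pos \<open>col (X n) a \<bullet> col (X n) a \<le> C * real n\<close> by (intro divide_right_mono mult_left_mono) auto
      also have "\<dots> = s * C / L\<^sup>2" using n by (simp add: power_mult_distrib)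
      finally show "prob (?Ba a) \<le> s * C / L\<^sup>2" .
    qed
    also have "(\<Sum>a<p. s * C / L\<^sup>2) = real p * (s * C / L\<^sup>2)" by simp
    also have "prob ?Bs \<le> q * real n / (s / 2 * real n)\<^sup>2"
      using s_pos n by (intro prob_noise_square) simp
    also have "\<dots> = q / (s / 2)\<^sup>2 / real n" using n by (simp add: power2_eq_square)
    finally have "1 - prob ?G < d" using Ld elim(3) by linarith
    then show ?case using G by simp
  qed
  with L show ?thesis by (intro exI[of _ L]) auto
qed

lemma consistency:
  assumes IC: "IC \<in> {IC_pi1, IC_pi1_star, IC_pi2, IC_r, IC_r_star}"
    and W: "\<And>j. j \<subseteq> {..<p} \<Longrightarrow> pos_def_mat (card j) (W j)"
  shows "(\<lambda>n. prob {\<omega> \<in> space M. \<forall>j. j \<subseteq> {..<p} \<and> j \<noteq> jstar \<longrightarrow>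
      IC W (X n) (mu n + noise n \<omega>) jstar < IC W (X n) (mu n + noise n \<omega>) j}) \<longlonglongrightarrow> 1"
    (is "(\<lambda>n. prob (?S n)) \<longlonglongrightarrow> 1")
proof (rule order_tendstoI)
  fix a :: real assume "a < 1"
  then have "0 < 1 - a" by simp
  \<comment> \<open>\<open>L\<close> depends on the target \<open>a\<close> only and is fixed before
    \<open>n\<close> grows.\<close>
  from prob_good[OF this] obtain L where L: "0 \<le> L" and ev: "\<forall>\<^sub>F n in sequentially.
    1 - (1 - a) < prob {\<omega> \<in> space M. noise n \<omega> \<in> good L n} \<and> {\<omega> \<in> space M. noise n \<omega> \<in> good L n} \<in> sets M"
    by auto
  have "log_n_penalized (\<lambda>n. IC_pi1 W (X n))" by (rule IC_pi1_penalized) (rule W)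
  moreover have "log_n_penalized (\<lambda>n. IC_pi1_star W (X n))" by (rule IC_pi1_star_penalized) (rule W)
  ultimately have "log_n_penalized (\<lambda>n. IC W (X n))"
    using IC IC_pi2_penalized[of W] IC_r_penalized[of W] IC_r_star_penalized[of W] by blast
  from log_n_penalized_selects[OF this L] ev
  show "\<forall>\<^sub>F n in sequentially. a < prob (?S n)"
  proof eventually_elim
    case (elim n)
    have y: "mu n + noise n \<omega> \<in> carrier_vec n" for \<omega> using mu_carrier by auto
    have y_meas: "(\<lambda>\<omega>. (mu n + noise n \<omega>) $ i) \<in> borel_measurable M" if "i < n" for i
      using that by simp
    have meas: "(\<lambda>\<omega>. IC W (X n) (mu n + noise n \<omega>) j) \<in> borel_measurable M" if "j \<subseteq> {..<p}" for j
      by (rule borel_measurable_IC[OF X_carrier that y y_meas IC])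
    \<comment> \<open>A finite intersection over models makes the event measurable, as monotonicity
      of the measure requires of the larger set.\<close>
    have S_eq: "?S n = {\<omega> \<in> space M. \<forall>j \<in> Pow {..<p} - {jstar}.
        IC W (X n) (mu n + noise n \<omega>) jstar < IC W (X n) (mu n + noise n \<omega>) j}" by auto
    have "?S n \<in> sets M"
      unfolding S_eq using meas jstar
      by (intro sets.sets_Collect_finite_All borel_measurable_less) auto
    then have "prob {\<omega> \<in> space M. noise n \<omega> \<in> good L n} \<le> prob (?S n)"
      using elim(1) by (intro finite_measure_mono) auto
    then show "a < prob (?S n)" using elim(2) by simp
  qed
next
  fix a :: real assume "1 < a"
  then show "\<forall>\<^sub>F n in sequentially. prob (?S n) < a"
    by (intro always_eventually allI) (meson le_less_trans prob_le_1)
qed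

end

text \<open>Strict inequality against every competitor excludes ties, so on this event every choice
  of a minimizer equals \<open>jstar\<close>.\<close>

theorem theorem1:
  fixes M :: "'a measure" and eps :: "nat \<Rightarrow> 'a \<Rightarrow> real"
    and X :: "nat \<Rightarrow> real mat" and p :: nat and jstar :: "nat set" and beta :: "real vec"
    and W :: "nat set \<Rightarrow> real mat"
    and IC :: "(nat set \<Rightarrow> real mat) \<Rightarrow> real mat \<Rightarrow> real vec \<Rightarrow> nat set \<Rightarrow> real"
  assumes P: "prob_space M"
    and eps_meas: "\<forall>i. eps i \<in> borel_measurable M"
    and eps_indep: "prob_space.indep_vars M (\<lambda>_. borel) eps UNIV"
    and eps_ident: "\<forall>i. distr M borel (eps i) = distr M borel (eps 0)"
    and A1: "integrable M (\<lambda>\<omega>. (eps 0 \<omega>) ^ 4)"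
    and mean0: "prob_space.expectation M (eps 0) = 0"
    and var_pos: "prob_space.variance M (eps 0) > 0"
    and X_dim: "\<forall>n. X n \<in> carrier_mat n p"
    and jstar: "jstar \<subseteq> {..<p}"
    and beta: "beta \<in> carrier_vec (card jstar)" "\<forall>k < card jstar. beta $ k \<noteq> 0"
    and Jplus_ne: "{j. j \<subseteq> {..<p} \<and> jstar \<subseteq> j} \<noteq> {}"
    and W: "\<forall>j. j \<subseteq> {..<p} \<longrightarrow> pos_def_mat (card j) (W j)"
    and A2_lower: "\<exists>c>0. \<forall>\<^sub>F n in sequentially. \<forall>j. j \<subseteq> {..<p} \<longrightarrow>
                      det ((1 / real n) \<cdot>\<^sub>m gram (X n) j) \<ge> c"
    and A2_upper: "\<exists>C. \<forall>\<^sub>F n in sequentially. \<forall>j. j \<subseteq> {..<p} \<longrightarrow>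
                      det ((1 / real n) \<cdot>\<^sub>m gram (X n) j) \<le> C"
    and A3: "\<exists>c>0. \<forall>\<^sub>F n in sequentially. \<forall>j. j \<subseteq> {..<p} \<and> \<not> jstar \<subseteq> j \<longrightarrow>
               (let mu = Xsub (X n) jstar *\<^sub>v beta; r = mu - hat (X n) j *\<^sub>v mu
                in (r \<bullet> r) / real n) \<ge> c"
    and IC: "IC \<in> {IC_pi1, IC_pi1_star, IC_pi2, IC_r, IC_r_star}"
  shows "(\<lambda>n. measure M {\<omega> \<in> space M.
            let y = Xsub (X n) jstar *\<^sub>v beta + vec n (\<lambda>i. eps i \<omega>) in
            \<forall>j. j \<subseteq> {..<p} \<and> j \<noteq> jstar \<longrightarrow> IC W (X n) y jstar < IC W (X n) y j})
         \<longlonglongrightarrow> 1"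
proof -
  interpret prob_space M by (rule P)
  have meas [measurable]: "eps i \<in> borel_measurable M" for i using eps_meas by simp
  define s where "s = variance (eps 0)"
  obtain c where c: "c > 0" "\<forall>\<^sub>F n in sequentially. \<forall>j. j \<subseteq> {..<p} \<longrightarrow> det ((1 / real n) \<cdot>\<^sub>m gram (X n) j) \<ge> c"
    using A2_lower by blast
  obtain C where C: "\<forall>\<^sub>F n in sequentially. \<forall>j. j \<subseteq> {..<p} \<longrightarrow> det ((1 / real n) \<cdot>\<^sub>m gram (X n) j) \<le> C"
    using A2_upper by blast
  obtain c' where c': "c' > 0" "\<forall>\<^sub>F n in sequentially. \<forall>j. j \<subseteq> {..<p} \<and> \<not> jstar \<subseteq> j \<longrightarrow>
               (let mu = Xsub (X n) jstar *\<^sub>v beta; r = mu - hat (X n) j *\<^sub>v mu in (r \<bullet> r) / real n) \<ge> c'"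
    using A3 by blast
  \<comment> \<open>Equal laws give equal integrals of every Borel function; this carries the
    moments of \<open>eps 0\<close> over to each \<open>eps i\<close>.\<close>
  have transfer: "(integrable M (\<lambda>\<omega>. f (eps i \<omega>)) \<longleftrightarrow> integrable M (\<lambda>\<omega>. f (eps 0 \<omega>)))
      \<and> expectation (\<lambda>\<omega>. f (eps i \<omega>)) = expectation (\<lambda>\<omega>. f (eps 0 \<omega>))"
    if f [measurable]: "f \<in> borel_measurable borel" for f :: "real \<Rightarrow> real" and i
    using integrable_distr_eq[OF meas f, of i] integrable_distr_eq[OF meas f, of 0]
      integral_distr[OF meas f, of i] integral_distr[OF meas f, of 0] eps_ident[rule_format, of i]
    by simp
  \<comment> \<open>Written as a square of a square, so that on a probability space the fourth
    moment yields the second.\<close>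
  have fourth: "integrable M (\<lambda>\<omega>. ((eps 0 \<omega>)\<^sup>2)\<^sup>2)" using A1 by simp
  have square: "integrable M (\<lambda>\<omega>. (eps 0 \<omega>)\<^sup>2)"
    by (rule square_integrable_imp_integrable[OF _ fourth]) measurable
  have s_eq: "expectation (\<lambda>\<omega>. (eps 0 \<omega>)\<^sup>2) = s" unfolding s_def using mean0 by simp
  have centred: "integrable M (\<lambda>\<omega>. ((eps 0 \<omega>)\<^sup>2 - s)\<^sup>2)"
    using fourth square unfolding power2_diff by (intro Bochner_Integration.integrable_add Bochner_Integration.integrable_diff) auto
  interpret random_regression X p c C jstar beta s c' M eps "expectation (\<lambda>\<omega>. ((eps 0 \<omega>)\<^sup>2 - s)\<^sup>2)"
  proof unfold_locales
    show "expectation (eps i) = 0" for i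
      using transfer[of "\<lambda>x. x" i] mean0 by simp
    show "integrable M (\<lambda>\<omega>. (eps i \<omega>)\<^sup>2)" "expectation (\<lambda>\<omega>. (eps i \<omega>)\<^sup>2) = s" for i
      using transfer[of "\<lambda>x. x\<^sup>2" i] square s_eq by auto
    show "integrable M (\<lambda>\<omega>. ((eps i \<omega>)\<^sup>2 - s)\<^sup>2)"
      "expectation (\<lambda>\<omega>. ((eps i \<omega>)\<^sup>2 - s)\<^sup>2) = expectation (\<lambda>\<omega>. ((eps 0 \<omega>)\<^sup>2 - s)\<^sup>2)" for i
      using transfer[of "\<lambda>x. (x\<^sup>2 - s)\<^sup>2" i] centred by auto
    show "0 < s" unfolding s_def by (rule var_pos)
    show "indep_vars (\<lambda>_. borel) eps UNIV" by (rule eps_indep)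
  qed (use X_dim c C c' jstar beta in auto)
  show ?thesis
    using consistency[OF IC, of W] W unfolding mu_def Let_def by simp
qed

end
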